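(* Let $\{x^k\}$ and $\{\lambda^k\}$ be generated by the augmented Lagrangian method described in the context. Suppose that $\{x^k\}_{k\in\mathcal{K}}$ converges to $x^\infty$ for some subsequence (infinite index set) $\mathcal{K}$. Assume that $x^\infty\in\Omega$, $\mathcal{I}_=(x^\infty)\ne\emptyset$, $\zeta_0(x^\infty)<\infty$, and the PSCQ holds for $\Omega$ at $x^\infty$. For any $j_0\in\mathcal{J}_0(x^\infty)$ and $\mathbf{j}=(j_1,\dots,j_I)\in\mathcal{J}(x^\infty)$, suppose that $x^{k,j_0,\mathbf{j}}\in X$ satisfies $$\mathrm{dist}\left(0,\ \partial\left[\widetilde Q_{\rho_k}(x;x^k,\lambda^k,j_0,\mathbf{j})+\iota_X(x)\right]\Big|_{x=x^{k,j_0,\mathbf{j}}}\right)\le\gamma_k$$ with $\{\gamma_k\}\to0$. Let $\lambda^{k,j_0,\mathbf{j}}=(\lambda_1^{k,j_0,\mathbf{j}},\dots,\lambda_I^{k,j_0,\mathbf{j}})$, where $$\lambda_i^{k,j_0,\mathbf{j}}=\left[\lambda_i^k+\rho_k\left(\hat\phi_i(x^{k,j_0,\mathbf{j}};x^k)+\zeta_i(x^{k,j_0,\mathbf{j}})-\ell_{\psi_{i,j_i}}(x^{k,j_0,\mathbf{j}};x^k)\right)\right]_+ .$$ Then the following statements hold. (i) $\{x^{k,j_0,\mathbf{j}}\}_{k\in\mathcal{K}}$ converges to $x^\infty$. (ii) $\{\lambda^{k,j_0,\mathbf{j}}\}_{k\in\mathcal{K}}$ is bounded. Moreover, every accumulation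 point $\lambda^{\infty,j_0,\mathbf{j}}$ of $\{\lambda^{k,j_0,\mathbf{j}}\}_{k\in\mathcal{K}}$ satisfies $$\lambda_i^{\infty,j_0,\mathbf{j}}\ge0,\qquad \lambda_i^{\infty,j_0,\mathbf{j}}\left[\phi_i(x^\infty)+\zeta_i(x^\infty)-\psi_{i,j_i}(x^\infty)\right]=0,\qquad\forall i\in\mathcal{I},$$ $$0\in\nabla\phi_0(x^\infty)+\partial\zeta_0(x^\infty)-\nabla\psi_{0,j_0}(x^\infty)+\sum_{i=1}^I\lambda_i^{\infty,j_0,\mathbf{j}}\left[\nabla\phi_i(x^\infty)+\partial\zeta_i(x^\infty)-\nabla\psi_{i,j_i}(x^\infty)\right]+\mathcal{N}_X(x^\infty).$$
   Context: Problem. Consider the DC program $$\text{(P)}\qquad \min_{x\in X}\ F(x)=\phi_0(x)+\zeta_0(x)-\psi_0(x)\quad\text{s.t.}\quad \phi_i(x)+\zeta_i(x)-\psi_i(x)\le 0,\ i=1,\dots,I,$$ where $\psi_i(x)=\max_{1\le j\le J_i}\psi_{i,j}(x)$ for $i=0,1,\dots,I$ and some integers $J_i$; $X\subseteq\mathbb{R}^n$ is closed and convex; the $\zeta_i$ are convex and continuous on an open set $\mathcal{S}\supseteq X$; the $\phi_i$ and $\psi_{i,j}$ are convex and continuously differentiable on $\mathcal{S}$; and $\|\nabla\phi_i(x)-\nabla\phi_i(y)\|\le L_i\|x-y\|$ for all $x,y\in X$, with $L_i\ge 0$ ($i=0,\dots,I$). It is assumed that $L_0>0$, and for $i\in\{1,\dots,I\}$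 one takes $L_i=0$ if $\phi_i$ is affine. Notation. $\|\cdot\|$ is the Euclidean norm; $[a]_+=\max\{a,0\}$, $[a]_+^2=([a]_+)^2$. $\iota_X$ is the indicator function of $X$ ($0$ on $X$, $+\infty$ elsewhere), $\partial$ is the convex subdifferential (with respect to $x$), $\mathrm{dist}$ is Euclidean distance from a point to a set, and $\mathcal{N}_X(x)=\{v:v^T(\bar x-x)\le0\ \forall\bar x\in X\}$ is the normal cone. $\mathcal{I}=\{1,\dots,I\}$, $\mathcal{J}_i=\{1,\dots,J_i\}$, $\mathcal{J}=\mathcal{J}_1\times\cdots\times\mathcal{J}_I$, with elements $\mathbf{j}=(j_1,\dots,j_I)$. $\Omega$ is the feasible region of (P). For $x\in X$: $\mathcal{J}_i(x)=\{j\in\mathcal{J}_i:\psi_i(x)=\psi_{i,j}(x)\}$ for $i=0,\dots,I$; $\mathcal{J}(x)=\mathcal{J}_1(x)\times\cdots\times\mathcal{J}_I(x)$; $\mathcal{I}_=(x)=\{i\in\mathcal{I}:\phi_i(x)+\zeta_i(x)-\psi_i(x)=0\}$. For $\epsilon>0$: $\mathcal{J}_{0,\epsilon}(x)=\{j\in\mathcal{J}_0:\psi_0(x)\le\psi_{0,j}(x)+\epsilon\}$ and $\mathcal{J}_\epsilon(x)=\{(j_1,\dots,j_I)\in\mathcal{J}:\psi_i(x)\le\psi_{i,j_i}(x)+\epsilon\ \forall i\in\mathcal{I}\}$. Tangent cone: for $x\in Y\subseteq\mathbb{R}^n$, $\mathcal{T}_Y(x)$ is the set of $d=\lim_k (x^k-x)/\tau_k$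 for some $x^k\in Y$, $x^k\to x$, $\tau_k\downarrow 0$. Directional derivative: $f'(x;d)=\lim_{\tau\downarrow0}(f(x+\tau d)-f(x))/\tau$. PSCQ. For $\bar x\in\Omega$ with $\mathcal{I}_=(\bar x)\neq\emptyset$, the pointwise Slater constraint qualification (PSCQ) holds for $\Omega$ at $\bar x$ if for every $\mathbf{j}=(j_1,\dots,j_I)\in\mathcal{J}(\bar x)$ there is $d_{\mathbf{j}}\in\mathcal{T}_X(\bar x)$ with $\nabla\phi_i(\bar x)^Td_{\mathbf{j}}+\zeta_i'(\bar x;d_{\mathbf{j}})-\nabla\psi_{i,j_i}(\bar x)^Td_{\mathbf{j}}<0$ for all $i\in\mathcal{I}_=(\bar x)$. Model functions. For $\bar x\in X$: $\ell_f(x;\bar x)=f(\bar x)+\nabla f(\bar x)^T(x-\bar x)$ for smooth $f$; $\hat\phi_i(x;\bar x)=\phi_i(\bar x)+\nabla\phi_i(\bar x)^T(x-\bar x)+\tfrac{L_i}{2}\|x-\bar x\|^2$. For $\rho>0$, $\lambda\in\mathbb{R}^I$, $j_0\in\mathcal{J}_0$, $\mathbf{j}=(j_1,\dots,j_I)\in\mathcal{J}$: $$\widetilde F_\rho(x,\lambda)=F(x)+\frac1{2\rho}\sum_{i=1}^I\left([\lambda_i+\rho(\phi_i(x)+\zeta_i(x)-\psi_i(x))]_+^2-\lambda_i^2\right),$$ $$\widetilde Q_\rho(x;\bar x,\lambda,j_0,\mathbf{j})=\hat\phi_0(x;\bar x)+\zeta_0(x)-\ell_{\psi_{0,j_0}}(x;\bar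 x)+\frac1{2\rho}\sum_{i=1}^I\left([\lambda_i+\rho(\hat\phi_i(x;\bar x)+\zeta_i(x)-\ell_{\psi_{i,j_i}}(x;\bar x))]_+^2-\lambda_i^2\right).$$ Augmented Lagrangian method. Input: $\epsilon>0$, $\rho_0>0$, $\alpha>0$, $\sigma>1$, $\lambda^0\in\mathbb{R}^I_+$, and a sequence $\{\eta_k\}$ of nonnegative reals with $\eta_k\to0$. For $k=0,1,2,\dots$: (1) find $x^k\in X$ such that $\widetilde F_{\rho_k}(x^k,\lambda^k)\le\widetilde Q_{\rho_k}(x;x^k,\lambda^k,j_0,\mathbf{j})+\eta_k$ for all $x\in X$, for every $j_0\in\mathcal{J}_{0,\epsilon}(x^k)$ and every $\mathbf{j}\in\mathcal{J}_\epsilon(x^k)$; (2) set $\lambda_i^{k+1}=[\lambda_i^k+\rho_k(\phi_i(x^k)+\zeta_i(x^k)-\psi_i(x^k))]_+$ for $i=1,\dots,I$; (3) set $\rho_{k+1}=\max\{\sigma\rho_k,\|\lambda^{k+1}\|^{1+\alpha}\}$. *)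

theory Defs
  imports "HOL-Analysis.Analysis"
begin

definition grad :: "('a::real_inner \<Rightarrow> real) \<Rightarrow> 'a \<Rightarrow> 'a" where
  "grad f x = (THE D. GDERIV f x :> D)"

definition C1_on :: "'a::real_inner set \<Rightarrow> ('a \<Rightarrow> real) \<Rightarrow> bool" where
  "C1_on S f \<longleftrightarrow> (\<forall>x\<in>S. \<exists>D. GDERIV f x :> D) \<and> continuous_on S (grad f)"

definition dirderiv :: "('a::real_normed_vector \<Rightarrow> real) \<Rightarrow> 'a \<Rightarrow> 'a \<Rightarrow> real" where
  "dirderiv f x d = Lim (at_right 0) (\<lambda>\<tau>. (f (x + \<tau> *\<^sub>R d) - f x) / \<tau>)"

definition tangent_cone :: "'a::real_normed_vector set \<Rightarrow> 'a \<Rightarrow> 'a set" where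
  "tangent_cone Y x =
    {d. \<exists>(u :: nat \<Rightarrow> 'a) (\<tau> :: nat \<Rightarrow> real).
        (\<forall>k. u k \<in> Y) \<and> u \<longlonglongrightarrow> x \<and> (\<forall>k. \<tau> k > 0) \<and> \<tau> \<longlonglongrightarrow> 0 \<and>
        (\<lambda>k. (u k - x) /\<^sub>R \<tau> k) \<longlonglongrightarrow> d}"

definition normal_cone :: "'a::real_inner set \<Rightarrow> 'a \<Rightarrow> 'a set" where
  "normal_cone X x = {v. \<forall>y\<in>X. v \<bullet> (y - x) \<le> 0}"

definition ind_fun :: "'a set \<Rightarrow> 'a \<Rightarrow> ereal" where
  "ind_fun A x = (if x \<in> A then 0 else \<infinity>)"

definition subdifferential :: "('a::real_inner \<Rightarrow> ereal) \<Rightarrow> 'a \<Rightarrow> 'a set" where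
  "subdifferential f x =
    {v. \<bar>f x\<bar> \<noteq> \<infinity> \<and> (\<forall>y. f x + ereal (v \<bullet> (y - x)) \<le> f y)}"

(* Unlike infdist and setdist, this gives \<infinity> for the empty set, so that a bound on the
   distance to a subdifferential entails that the subdifferential is nonempty. *)
definition edist_to_set :: "'a::metric_space \<Rightarrow> 'a set \<Rightarrow> ereal" where
  "edist_to_set x A = (INF y\<in>A. ereal (dist x y))"

(* A record p stands for the function phi p + zeta p - max {psi p j | j = 1..npieces p},
   where Lip p is the Lipschitz constant used for the gradient of phi p.
   In the sequel P0 is the objective and P i (i :: 'i) are the constraint functions;
   the finite type 'i is the index set {1..I}. *)
record 'a dc_fun =
  phi :: "'a \<Rightarrow> real"
  Lip :: real
  zeta :: "'a \<Rightarrow> real"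
  npieces :: nat
  psi :: "nat \<Rightarrow> 'a \<Rightarrow> real"

definition psi_max :: "'a dc_fun \<Rightarrow> 'a \<Rightarrow> real" where
  "psi_max p x = Max ((\<lambda>j. psi p j x) ` {1..npieces p})"

definition dc_val :: "'a dc_fun \<Rightarrow> 'a \<Rightarrow> real" where
  "dc_val p x = phi p x + zeta p x - psi_max p x"

definition active_pieces :: "'a dc_fun \<Rightarrow> 'a \<Rightarrow> nat set" where
  "active_pieces p x = {j \<in> {1..npieces p}. psi_max p x = psi p j x}"

definition eps_active_pieces :: "real \<Rightarrow> 'a dc_fun \<Rightarrow> 'a \<Rightarrow> nat set" where
  "eps_active_pieces \<epsilon> p x = {j \<in> {1..npieces p}. psi_max p x \<le> psi p j x + \<epsilon>}"

definition dc_fun_on :: "'a::real_inner set \<Rightarrow> 'a set \<Rightarrow> 'a dc_fun \<Rightarrow> bool" where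
  "dc_fun_on S X p \<longleftrightarrow>
     convex_on S (zeta p) \<and> continuous_on S (zeta p) \<and>
     convex_on S (phi p) \<and> C1_on S (phi p) \<and>
     npieces p \<ge> 1 \<and>
     (\<forall>j\<in>{1..npieces p}. convex_on S (psi p j) \<and> C1_on S (psi p j)) \<and>
     (Lip p)-lipschitz_on X (grad (phi p))"

definition dc_program ::
  "'a::real_inner set \<Rightarrow> 'a set \<Rightarrow> 'a dc_fun \<Rightarrow> ('i \<Rightarrow> 'a dc_fun) \<Rightarrow> bool" where
  "dc_program S X P0 P \<longleftrightarrow>
     open S \<and> closed X \<and> convex X \<and> X \<subseteq> S \<and>
     dc_fun_on S X P0 \<and> (\<forall>i. dc_fun_on S X (P i)) \<and>
     Lip P0 > 0 \<and>
     (\<forall>i. (\<exists>a b. \<forall>x\<in>S. phi (P i) x = a \<bullet> x + b) \<longrightarrow> Lip (P i) = 0)"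

definition feasible_set :: "'a set \<Rightarrow> ('i \<Rightarrow> 'a dc_fun) \<Rightarrow> 'a set" where
  "feasible_set X P = {x \<in> X. \<forall>i. dc_val (P i) x \<le> 0}"

definition active_constraints :: "('i \<Rightarrow> 'a dc_fun) \<Rightarrow> 'a \<Rightarrow> 'i set" where
  "active_constraints P x = {i. dc_val (P i) x = 0}"

definition active_selections :: "('i \<Rightarrow> 'a dc_fun) \<Rightarrow> 'a \<Rightarrow> ('i \<Rightarrow> nat) set" where
  "active_selections P x = {j. \<forall>i. j i \<in> active_pieces (P i) x}"

definition eps_active_selections ::
  "real \<Rightarrow> ('i \<Rightarrow> 'a dc_fun) \<Rightarrow> 'a \<Rightarrow> ('i \<Rightarrow> nat) set" where
  "eps_active_selections \<epsilon> P x = {j. \<forall>i. j i \<in> eps_active_pieces \<epsilon> (P i) x}"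

definition PSCQ :: "'a::real_inner set \<Rightarrow> ('i \<Rightarrow> 'a dc_fun) \<Rightarrow> 'a \<Rightarrow> bool" where
  "PSCQ X P x \<longleftrightarrow>
     (\<forall>j\<in>active_selections P x. \<exists>d\<in>tangent_cone X x. \<forall>i\<in>active_constraints P x.
        grad (phi (P i)) x \<bullet> d + dirderiv (zeta (P i)) x d - grad (psi (P i) (j i)) x \<bullet> d < 0)"

(* zeta p is only meaningful on S; it is extended by \<infinity> outside S. *)
definition zeta_subdiff :: "'a::real_inner set \<Rightarrow> 'a dc_fun \<Rightarrow> 'a \<Rightarrow> 'a set" where
  "zeta_subdiff S p x = subdifferential (\<lambda>y. ereal (zeta p y) + ind_fun S y) x"

definition linearization :: "('a::real_inner \<Rightarrow> real) \<Rightarrow> 'a \<Rightarrow> 'a \<Rightarrow> real" where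
  "linearization f xb x = f xb + grad f xb \<bullet> (x - xb)"

definition phi_hat :: "'a::real_inner dc_fun \<Rightarrow> 'a \<Rightarrow> 'a \<Rightarrow> real" where
  "phi_hat p xb x = phi p xb + grad (phi p) xb \<bullet> (x - xb) + Lip p / 2 * (norm (x - xb))\<^sup>2"

definition model_val :: "'a::real_inner dc_fun \<Rightarrow> nat \<Rightarrow> 'a \<Rightarrow> 'a \<Rightarrow> real" where
  "model_val p j xb x = phi_hat p xb x + zeta p x - linearization (psi p j) xb x"

definition AL_penalty :: "real \<Rightarrow> real ^ 'i \<Rightarrow> ('i::finite \<Rightarrow> real) \<Rightarrow> real" where
  "AL_penalty \<rho> lam c =
     1 / (2 * \<rho>) * (\<Sum>i\<in>UNIV. (max (lam $ i + \<rho> * c i) 0)\<^sup>2 - (lam $ i)\<^sup>2)"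

definition F_AL ::
  "'a::real_inner dc_fun \<Rightarrow> ('i::finite \<Rightarrow> 'a dc_fun) \<Rightarrow> real \<Rightarrow> 'a \<Rightarrow> real ^ 'i \<Rightarrow> real" where
  "F_AL P0 P \<rho> x lam = dc_val P0 x + AL_penalty \<rho> lam (\<lambda>i. dc_val (P i) x)"

definition Q_AL ::
  "'a::real_inner dc_fun \<Rightarrow> ('i::finite \<Rightarrow> 'a dc_fun) \<Rightarrow> real \<Rightarrow> 'a \<Rightarrow> 'a \<Rightarrow> real ^ 'i
    \<Rightarrow> nat \<Rightarrow> ('i \<Rightarrow> nat) \<Rightarrow> real" where
  "Q_AL P0 P \<rho> x xb lam j0 j =
     model_val P0 j0 xb x + AL_penalty \<rho> lam (\<lambda>i. model_val (P i) (j i) xb x)"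

definition model_multiplier ::
  "('i::finite \<Rightarrow> 'a::real_inner dc_fun) \<Rightarrow> real \<Rightarrow> 'a \<Rightarrow> 'a \<Rightarrow> real ^ 'i \<Rightarrow> ('i \<Rightarrow> nat)
    \<Rightarrow> real ^ 'i" where
  "model_multiplier P \<rho> x xb lam j =
     (\<chi> i. max (lam $ i + \<rho> * model_val (P i) (j i) xb x) 0)"

definition ALM_input ::
  "real \<Rightarrow> real \<Rightarrow> real \<Rightarrow> real \<Rightarrow> real ^ 'i \<Rightarrow> (nat \<Rightarrow> real) \<Rightarrow> bool" where
  "ALM_input \<epsilon> \<rho>0 \<alpha> \<sigma> lam0 \<eta> \<longleftrightarrow>
     \<epsilon> > 0 \<and> \<rho>0 > 0 \<and> \<alpha> > 0 \<and> \<sigma> > 1 \<and> (\<forall>i. lam0 $ i \<ge> 0) \<and>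
     (\<forall>k. \<eta> k \<ge> 0) \<and> \<eta> \<longlonglongrightarrow> 0"

definition ALM_iterates ::
  "'a::real_inner set \<Rightarrow> 'a dc_fun \<Rightarrow> ('i::finite \<Rightarrow> 'a dc_fun) \<Rightarrow>
   real \<Rightarrow> real \<Rightarrow> real \<Rightarrow> real \<Rightarrow> real ^ 'i \<Rightarrow> (nat \<Rightarrow> real) \<Rightarrow>
   (nat \<Rightarrow> 'a) \<Rightarrow> (nat \<Rightarrow> real ^ 'i) \<Rightarrow> (nat \<Rightarrow> real) \<Rightarrow> bool" where
  "ALM_iterates X P0 P \<epsilon> \<rho>0 \<alpha> \<sigma> lam0 \<eta> x lam \<rho> \<longleftrightarrow>
     lam 0 = lam0 \<and> \<rho> 0 = \<rho>0 \<and>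
     (\<forall>k. x k \<in> X \<and>
        (\<forall>j0\<in>eps_active_pieces \<epsilon> P0 (x k). \<forall>j\<in>eps_active_selections \<epsilon> P (x k). \<forall>z\<in>X.
           F_AL P0 P (\<rho> k) (x k) (lam k) \<le> Q_AL P0 P (\<rho> k) z (x k) (lam k) j0 j + \<eta> k) \<and>
        lam (Suc k) = (\<chi> i. max (lam k $ i + \<rho> k * dc_val (P i) (x k)) 0) \<and>
        \<rho> (Suc k) = max (\<sigma> * \<rho> k) (norm (lam (Suc k)) powr (1 + \<alpha>)))"

end

theory Submission
  imports Defs
begin

text \<open>
  The subproblem at an iterate is a convex program in disguise: \<^const>\<open>Q_AL\<close> is the augmented Lagrangian of
  minimizing the strongly convex model of the objective subject to the convex models of the
  constraints, and \<^const>\<open>model_multiplier\<close> is its multiplier update. Two observations carry the proof.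

  First, a small subgradient of the augmented Lagrangian at its approximate minimizer is a subgradient
  of the ordinary Lagrangian with the updated multipliers (\<open>Lagrangian_inequality_of_subgradient\<close>), and
  this inequality retains the strong convexity of the objective model. Secondly, the pointwise Slater
  condition provides Slater points of the convex models arbitrarily close to the limit of the iterates
  (\<open>PSCQ_imp_Slater_points\<close>). Since the penalty update makes the old multipliers negligible compared with
  the penalty parameter, all penalty terms are switched off at such a point.

  Evaluating the Lagrangian inequality at a Slater point bounds the multipliers
  (\<open>multipliers_eventually_bounded\<close>), whence the model solutions become feasible in the limit. The midpoint
  between a model solution and a Slater point is then a Slater point as well. The iterate nearly
  minimizes the model, so this midpoint cannot improve on it in the limit, and strong convexity keeps the
  model solution close to the Slater point, hence to the limit of the iterates (\<open>solutions_tendsto\<close>).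

  With the model solutions converging, the Lagrangian inequality passes to the limit along any
  convergent sequence of multipliers: the limit point minimizes the limiting convex Lagrangian over the
  constraint set. Stationarity follows from a subdifferential sum rule (\<open>subgradient_sum_rule\<close>), which is
  obtained from hyperplane separation. Complementarity holds because the multiplier of an inactive
  constraint eventually vanishes.
\<close>

section \<open>Subgradients of convex functions\<close>

text \<open>
  One function at a time can be peeled off a sum: at a minimizer \<open>x\<close> of \<open>f + g\<close> over \<open>X\<close>, the function
  \<open>f\<close> may be replaced by a linear one whose slope is a subgradient of \<open>f\<close>. Minimality says that the strict
  epigraph of \<open>f - f x\<close> misses the hypograph of \<open>g x - g\<close>, and the slope of a hyperplane that separates
  the two is the subgradient.
\<close>

lemma subgradient_split:
  fixes f g :: "'a::euclidean_space \<Rightarrow> real"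
  assumes S: "open S" and f: "convex_on S f" and g: "convex_on X g"
    and XS: "X \<subseteq> S" and x: "x \<in> X"
    and min: "\<And>y. y \<in> X \<Longrightarrow> f x + g x \<le> f y + g y"
  shows "\<exists>u. (\<forall>y\<in>S. f x + u \<bullet> (y - x) \<le> f y) \<and> (\<forall>y\<in>X. u \<bullet> x + g x \<le> u \<bullet> y + g y)"
proof -
  define A where "A = {yt. fst yt \<in> S \<and> f (fst yt) - f x < snd yt}"
  define B where "B = {yt. fst yt \<in> X \<and> snd yt \<le> g x - g (fst yt)}"
  have xS: "x \<in> S" using x XS by blast
  have cS: "convex S" and cX: "convex X" using f g by (auto simp: convex_on_def)
  have "convex A"
  proof (rule convexI)
    fix y z :: "'a \<times> real" and a b :: real
    assume yz: "y \<in> A" "z \<in> A" and ab: "a \<ge> 0" "b \<ge> 0" "a + b = 1"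
    have "f (a *\<^sub>R fst y + b *\<^sub>R fst z) \<le> a * f (fst y) + b * f (fst z)"
      using f yz ab unfolding convex_on_def A_def by auto
    moreover have "a * (f (fst y) - f x) + b * (f (fst z) - f x) < a * snd y + b * snd z"
      using yz ab unfolding A_def
      by (smt (verit) mem_Collect_eq mult_left_mono mult_strict_left_mono)
    moreover have "a * (f (fst y) - f x) + b * (f (fst z) - f x)
        = a * f (fst y) + b * f (fst z) - (a + b) * f x" by (simp add: algebra_simps)
    ultimately show "a *\<^sub>R y + b *\<^sub>R z \<in> A"
      using yz ab cS unfolding A_def convex_def by auto
  qed
  moreover have "convex B"
  proof (rule convexI)
    fix y z :: "'a \<times> real" and a b :: real
    assume yz: "y \<in> B" "z \<in> B" and ab: "a \<ge> 0" "b \<ge> 0" "a + b = 1"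
    have "g (a *\<^sub>R fst y + b *\<^sub>R fst z) \<le> a * g (fst y) + b * g (fst z)"
      using g yz ab unfolding convex_on_def B_def by auto
    moreover have "a * snd y + b * snd z \<le> a * (g x - g (fst y)) + b * (g x - g (fst z))"
      using yz ab unfolding B_def by (auto intro!: add_mono mult_left_mono)
    moreover have "a * (g x - g (fst y)) + b * (g x - g (fst z))
        = (a + b) * g x - (a * g (fst y) + b * g (fst z))" by (simp add: algebra_simps)
    ultimately show "a *\<^sub>R y + b *\<^sub>R z \<in> B"
      using yz ab cX unfolding B_def convex_def by auto
  qed
  moreover have "(x, 1) \<in> A" "(x, 0) \<in> B" using x xS by (auto simp: A_def B_def)
  moreover have "A \<inter> B = {}" using min by (fastforce simp: A_def B_def)
  ultimately obtain a b where ab: "a \<noteq> 0" "\<forall>yt\<in>A. a \<bullet> yt \<le> b" "\<forall>yt\<in>B. a \<bullet> yt \<ge> b"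
    using separating_hyperplane_sets[of A B] by blast
  obtain p q where a: "a = (p, q)" by (cases a)
  have sepA: "p \<bullet> y + q * t \<le> b" if "y \<in> S" "f y - f x < t" for y t
    using ab(2) that by (force simp: A_def a)
  have sepB: "p \<bullet> y + q * t \<ge> b" if "y \<in> X" "t \<le> g x - g y" for y t
    using ab(3) that by (force simp: B_def a)
  have bx: "b \<le> p \<bullet> x" using sepB[OF x, of 0] by simp
  have sepA': "p \<bullet> y + q * (f y - f x) \<le> b" if "y \<in> S" for y
  proof (rule tendsto_upperbound)
    show "((\<lambda>t. p \<bullet> y + q * t) \<longlongrightarrow> p \<bullet> y + q * (f y - f x)) (at_right (f y - f x))"
      by (intro tendsto_intros)
    show "\<forall>\<^sub>F t in at_right (f y - f x). p \<bullet> y + q * t \<le> b"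
      using sepA[OF that] by (auto simp: eventually_at_filter)
  qed simp
  have b: "b = p \<bullet> x" using sepA'[OF xS] bx by simp
  have "q \<le> 0" using sepA[OF xS, of 1] bx by simp
  \<comment> \<open>A vertical hyperplane is impossible because \<open>x\<close> is interior to \<open>S\<close>.\<close>
  have "q \<noteq> 0"
  proof
    assume q: "q = 0"
    obtain e where e: "e > 0" "ball x e \<subseteq> S" using S xS open_contains_ball by blast
    define y where "y = x + (e / (2 * (norm p + 1))) *\<^sub>R p"
    have "norm ((e / (2 * (norm p + 1))) *\<^sub>R p) < e"
    proof -
      have "e * norm p < e * (2 * (norm p + 1))" using e(1)
        by (intro mult_strict_left_mono) (auto intro: add_nonneg_pos add_strict_increasing)
      moreover have "0 < 2 * (norm p + 1)" by (simp add: add_nonneg_pos)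
      ultimately show ?thesis using e(1) by (simp add: divide_simps)
    qed
    then have "y \<in> S" using e(2) by (auto simp: y_def dist_norm subset_iff)
    then have "p \<bullet> y \<le> p \<bullet> x" using sepA'[of y] b q by simp
    then have "(e / (2 * (norm p + 1))) * (p \<bullet> p) \<le> 0" by (simp add: y_def inner_add_right)
    moreover have "e / (2 * (norm p + 1)) > 0" using e(1) by (simp add: add_nonneg_pos)
    ultimately have "p \<bullet> p \<le> 0" by (metis mult_pos_pos not_le)
    moreover have "p \<noteq> 0" using ab(1) q a by (simp add: zero_prod_def)
    then have "0 < p \<bullet> p" by simp
    ultimately show False by linarith
  qed
  with \<open>q \<le> 0\<close> have q: "q < 0" by simp
  define u where "u = (1 / - q) *\<^sub>R p"
  have pu: "p = (- q) *\<^sub>R u" using q by (simp add: u_def)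
  show ?thesis
  proof (intro exI[of _ u] conjI ballI)
    fix y assume "y \<in> S"
    then have "(- q) * (u \<bullet> y - (f y - f x)) \<le> (- q) * (u \<bullet> x)"
      using sepA'[of y] b by (simp add: pu algebra_simps)
    then have "u \<bullet> y - (f y - f x) \<le> u \<bullet> x" using q by (simp add: mult_le_cancel_left_neg)
    then show "f x + u \<bullet> (y - x) \<le> f y" by (simp add: inner_diff_right)
  next
    fix y assume "y \<in> X"
    then have "(- q) * (u \<bullet> x) \<le> (- q) * (u \<bullet> y - (g x - g y))"
      using sepB[of y "g x - g y"] b by (simp add: pu algebra_simps)
    then have "u \<bullet> x \<le> u \<bullet> y - (g x - g y)" using q by (simp add: mult_le_cancel_left_neg)
    then show "u \<bullet> x + g x \<le> u \<bullet> y + g y" by simp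
  qed
qed

text \<open>
  Every function is minimal over a one-point set, so splitting there produces a subgradient.
\<close>

lemma subgradient_exists:
  fixes f :: "'a::euclidean_space \<Rightarrow> real"
  assumes "open S" "convex_on S f" "x \<in> S"
  shows "\<exists>u. \<forall>y\<in>S. f x + u \<bullet> (y - x) \<le> f y"
  using subgradient_split[of S f "{x}" "\<lambda>_. 0" x] assms by (auto simp: convex_on_def)

text \<open>
  The case \<open>w = 0\<close> is included: the function then has no influence on the minimum, but its
  subgradient is still required to exist, since a vanishing multiplier in the stationarity condition
  multiplies an element of the subdifferential.
\<close>

lemma subgradient_split_scaled:
  fixes f g :: "'a::euclidean_space \<Rightarrow> real"
  assumes S: "open S" and f: "convex_on S f" and g: "convex_on X g"
    and XS: "X \<subseteq> S" and x: "x \<in> X" and w: "w \<ge> 0"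
    and min: "\<And>y. y \<in> X \<Longrightarrow> w * f x + g x \<le> w * f y + g y"
  shows "\<exists>u. (\<forall>y\<in>S. f x + u \<bullet> (y - x) \<le> f y) \<and>
    (\<forall>y\<in>X. w * (u \<bullet> x) + g x \<le> w * (u \<bullet> y) + g y)"
proof (cases "w = 0")
  case True
  then show ?thesis using subgradient_exists[OF S f, of x] min x XS by auto
next
  case False
  then have w: "w > 0" using w by simp
  obtain u where u: "\<forall>y\<in>S. w * f x + u \<bullet> (y - x) \<le> w * f y" 
      "\<forall>y\<in>X. u \<bullet> x + g x \<le> u \<bullet> y + g y"
    using subgradient_split[OF S _ g XS x min] convex_on_cmul[of w S f] f w by auto
  have wu: "w * (((1 / w) *\<^sub>R u) \<bullet> y) = u \<bullet> y" for y using w by simp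
  show ?thesis
  proof (intro exI[of _ "(1 / w) *\<^sub>R u"] conjI ballI)
    fix y assume "y \<in> S"
    then have "w * (f x + ((1 / w) *\<^sub>R u) \<bullet> (y - x)) \<le> w * f y"
      using u(1) wu[of "y - x"] by (simp only: distrib_left)
    then show "f x + ((1 / w) *\<^sub>R u) \<bullet> (y - x) \<le> f y" using w by (simp only: mult_le_cancel_left_pos)
  qed (use u(2) wu in auto)
qed

lemma convex_on_inner: "convex X \<Longrightarrow> convex_on X (\<lambda>y. c * (u \<bullet> y))"
  by (auto simp: convex_on_def inner_add_right algebra_simps)

lemma convex_on_weighted_sum:
  fixes f :: "'i \<Rightarrow> 'a::real_vector \<Rightarrow> real"
  assumes "convex X" "finite A"
    and "\<And>i. i \<in> A \<Longrightarrow> convex_on X (f i)" "\<And>i. i \<in> A \<Longrightarrow> w i \<ge> 0"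
  shows "convex_on X (\<lambda>y. \<Sum>i\<in>A. w i * f i y)"
  using assms(2,3,4)
  by (induction A rule: finite_induct)
    (auto intro!: convex_on_add convex_on_cmul simp: convex_on_const assms(1))

lemma subgradient_sum_rule:
  fixes f :: "'i \<Rightarrow> 'a::euclidean_space \<Rightarrow> real"
  assumes S: "open S" and fin: "finite A"
    and f: "\<And>i. i \<in> A \<Longrightarrow> convex_on S (f i)" and w: "\<And>i. i \<in> A \<Longrightarrow> w i \<ge> 0"
    and g: "convex_on X g" and XS: "X \<subseteq> S" and x: "x \<in> X"
    and min: "\<And>y. y \<in> X \<Longrightarrow> (\<Sum>i\<in>A. w i * f i x) + g x \<le> (\<Sum>i\<in>A. w i * f i y) + g y"
  shows "\<exists>u. (\<forall>i\<in>A. \<forall>y\<in>S. f i x + u i \<bullet> (y - x) \<le> f i y) \<and>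
    (\<forall>y\<in>X. (\<Sum>i\<in>A. w i * (u i \<bullet> x)) + g x \<le> (\<Sum>i\<in>A. w i * (u i \<bullet> y)) + g y)"
  using fin f w g min
proof (induction A arbitrary: g rule: finite_induct)
  case empty
  then show ?case by auto
next
  case (insert a A)
  have cX: "convex X" using insert.prems by (auto simp: convex_on_def)
  have cS: "convex_on X (f i)" if "i \<in> insert a A" for i
    using insert.prems(1)[OF that] XS cX by (meson convex_on_subset)
  have rest: "convex_on X (\<lambda>y. (\<Sum>i\<in>A. w i * f i y) + g y)"
    using insert.prems cS insert.hyps(1)
    by (intro convex_on_add convex_on_weighted_sum) (auto simp: cX)
  obtain ua where ua: "\<forall>y\<in>S. f a x + ua \<bullet> (y - x) \<le> f a y"
      "\<forall>y\<in>X. w a * (ua \<bullet> x) + ((\<Sum>i\<in>A. w i * f i x) + g x)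
        \<le> w a * (ua \<bullet> y) + ((\<Sum>i\<in>A. w i * f i y) + g y)"
    using subgradient_split_scaled[OF S insert.prems(1)[of a] rest XS x insert.prems(2)[of a]]
      insert.prems(4) insert.hyps by (auto simp: add.assoc)
  have "convex_on X (\<lambda>y. w a * (ua \<bullet> y) + g y)"
    using insert.prems(3) cX by (intro convex_on_add convex_on_inner)
  from insert.IH[OF _ _ this] obtain u where
    u: "\<forall>i\<in>A. \<forall>y\<in>S. f i x + u i \<bullet> (y - x) \<le> f i y"
      "\<forall>y\<in>X. (\<Sum>i\<in>A. w i * (u i \<bullet> x)) + (w a * (ua \<bullet> x) + g x)
        \<le> (\<Sum>i\<in>A. w i * (u i \<bullet> y)) + (w a * (ua \<bullet> y) + g y)"
    using insert.prems(1,2) ua(2) by (auto simp: algebra_simps)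
  have s: "(\<Sum>i\<in>A. w i * ((u(a := ua)) i \<bullet> y)) = (\<Sum>i\<in>A. w i * (u i \<bullet> y))" for y
    using insert.hyps(2) by (intro sum.cong) auto
  show ?case
  proof (intro exI[of _ "u(a := ua)"] conjI)
    show "\<forall>i\<in>insert a A. \<forall>y\<in>S. f i x + (u(a := ua)) i \<bullet> (y - x) \<le> f i y"
      using u(1) ua(1) by simp
    have eq: "(\<Sum>i\<in>insert a A. w i * ((u(a := ua)) i \<bullet> y)) + g y
        = (\<Sum>i\<in>A. w i * (u i \<bullet> y)) + (w a * (ua \<bullet> y) + g y)" for y
      using insert.hyps s[of y] by simp
    show "\<forall>y\<in>X. (\<Sum>i\<in>insert a A. w i * ((u(a := ua)) i \<bullet> x)) + g x
        \<le> (\<Sum>i\<in>insert a A. w i * ((u(a := ua)) i \<bullet> y)) + g y"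
      unfolding eq by (rule u(2))
  qed
qed

text \<open>
  The difference quotients of a convex function decrease as the step shrinks and are bounded below by
  means of a subgradient. Hence they converge, so that \<^const>\<open>dirderiv\<close> is a genuine limit, and a strict
  upper bound on it is already attained by some quotient with a positive step.
\<close>

lemma dirderiv_less_imp_quotient_less:
  fixes f :: "'a::euclidean_space \<Rightarrow> real"
  assumes S: "open S" and f: "convex_on S f" and x: "x \<in> S" and c: "dirderiv f x d < c"
  shows "\<exists>t>0. x + t *\<^sub>R d \<in> S \<and> (f (x + t *\<^sub>R d) - f x) / t < c"
proof -
  define q where "q t = (f (x + t *\<^sub>R d) - f x) / t" for t
  obtain e where e: "e > 0" "ball x e \<subseteq> S" using S x open_contains_ball by blast
  define T where "T = e / (norm d + 1)"
  have T: "T > 0" using e(1) by (simp add: T_def add_nonneg_pos)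
  have inS: "x + t *\<^sub>R d \<in> S" if "0 < t" "t < T" for t
  proof -
    have "norm (t *\<^sub>R d) \<le> t * (norm d + 1)" using that by (simp add: mult_left_mono)
    also have "\<dots> < e" using that by (simp add: T_def less_divide_eq add_nonneg_pos)
    finally show ?thesis using e(2) by (auto simp: dist_norm subset_iff)
  qed
  have mono: "q s \<le> q t" if "0 < s" "s \<le> t" "t < T" for s t
  proof -
    have "t \<noteq> 0" using that by simp
    then have comb: "(1 - s / t) *\<^sub>R x + (s / t) *\<^sub>R (x + t *\<^sub>R d) = x + s *\<^sub>R d"
      by (simp add: algebra_simps)
    have "f ((1 - s / t) *\<^sub>R x + (s / t) *\<^sub>R (x + t *\<^sub>R d))
        \<le> (1 - s / t) * f x + (s / t) * f (x + t *\<^sub>R d)"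
      using that x inS[of t] by (intro convex_onD[OF f]) auto
    then have "f (x + s *\<^sub>R d) - f x \<le> s * q t"
      unfolding comb by (simp add: q_def algebra_simps diff_divide_distrib)
    then show ?thesis using that by (simp add: q_def[of s] divide_le_eq mult.commute)
  qed
  obtain u where u: "\<forall>y\<in>S. f x + u \<bullet> (y - x) \<le> f y"
    using subgradient_exists[OF S f x] by blast
  have lower: "u \<bullet> d \<le> q t" if "0 < t" "t < T" for t
    using u inS[OF that] that by (force simp: q_def le_divide_eq mult.commute)
  define l where "l = Inf (q ` {0<..<T})"
  have bdd: "bdd_below (q ` {0<..<T})" using lower by (intro bdd_belowI[of _ "u \<bullet> d"]) auto
  have near0: "\<forall>\<^sub>F t in at_right 0. t < T'" if "0 < T'" for T' :: real
    using that by (auto intro: eventually_at_right_less order_tendstoD tendsto_ident_at)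
  have pos: "\<forall>\<^sub>F t in at_right (0::real). 0 < t" by (simp add: eventually_at_right_less)
  have "(q \<longlongrightarrow> l) (at_right 0)"
  proof (rule order_tendstoI)
    fix a assume a: "a < l"
    show "\<forall>\<^sub>F t in at_right 0. a < q t"
      using near0[OF T] pos
    proof eventually_elim
      case (elim t)
      then have "l \<le> q t" unfolding l_def using bdd by (intro cInf_lower) auto
      then show ?case using a by simp
    qed
  next
    fix a assume a: "l < a"
    have "q ` {0<..<T} \<noteq> {}" using T by simp
    then obtain t1 where t1: "0 < t1" "t1 < T" "q t1 < a"
      using a bdd by (auto simp: l_def cInf_less_iff)
    show "\<forall>\<^sub>F t in at_right 0. q t < a"
      using near0[OF t1(1)] pos
    proof eventually_elim
      case (elim t)
      then show ?case using mono[of t t1] t1 by auto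
    qed
  qed
  then have lim: "(q \<longlongrightarrow> l) (at_right 0)" .
  have "dirderiv f x d = l"
    unfolding dirderiv_def q_def[symmetric] by (rule tendsto_Lim[OF trivial_limit_at_right_real lim])
  with lim c have "l < c" by simp
  have "\<forall>\<^sub>F t in at_right 0. q t < c" using order_tendstoD(2)[OF lim \<open>l < c\<close>] .
  then have "\<forall>\<^sub>F t in at_right 0. q t < c \<and> 0 < t \<and> t < T"
    using near0[OF T] pos by eventually_elim auto
  then obtain t where "q t < c" "0 < t" "t < T"
    using eventually_happens'[OF trivial_limit_at_right_real] by blast
  then show ?thesis using inS unfolding q_def by blast
qed

section \<open>Convexity and continuity of the models\<close>

lemma C1_on_imp_continuous_on:
  assumes "C1_on S f"
  shows "continuous_on S f"
proof (rule continuous_at_imp_continuous_on, rule ballI)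
  fix x assume "x \<in> S"
  then obtain D where "GDERIV f x :> D" using assms by (auto simp: C1_on_def)
  then show "isCont f x" unfolding gderiv_def by (rule has_derivative_continuous)
qed

lemma C1_on_linearization_tendsto:
  assumes "open S" "C1_on S f" "a \<in> S" "(xb \<longlongrightarrow> a) F" "(y \<longlongrightarrow> b) F"
  shows "((\<lambda>m. linearization f (xb m) (y m)) \<longlongrightarrow> linearization f a b) F"
proof -
  have "isCont f a" "isCont (grad f) a"
    using assms(1-3) C1_on_imp_continuous_on[of S f]
    by (auto simp: C1_on_def continuous_on_eq_continuous_at)
  then show ?thesis unfolding linearization_def
    using assms(4,5) by (intro tendsto_intros isCont_tendsto_compose[where g = f]
        isCont_tendsto_compose[where g = "grad f"])
qed

lemma phi_hat_eq_linearization: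
  "phi_hat p xb x = linearization (phi p) xb x + Lip p / 2 * (norm (x - xb))\<^sup>2"
  by (simp add: phi_hat_def linearization_def)

lemma model_val_tendsto:
  assumes "open S" "dc_fun_on S X p" "jp \<in> {1..npieces p}" "a \<in> S" "b \<in> S"
    and "(xb \<longlongrightarrow> a) F" "(y \<longlongrightarrow> b) F"
  shows "((\<lambda>m. model_val p jp (xb m) (y m)) \<longlongrightarrow> model_val p jp a b) F"
proof -
  have "isCont (zeta p) b" using assms by (auto simp: dc_fun_on_def continuous_on_eq_continuous_at)
  moreover have "C1_on S (phi p)" "C1_on S (psi p jp)" using assms by (auto simp: dc_fun_on_def)
  ultimately show ?thesis unfolding model_val_def phi_hat_eq_linearization
    using assms by (intro tendsto_intros C1_on_linearization_tendsto[of S]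
        isCont_tendsto_compose[where g = "zeta p"])
qed

lemma Lip_nonneg: "dc_fun_on S X p \<Longrightarrow> Lip p \<ge> 0"
  by (auto simp: dc_fun_on_def intro: lipschitz_on_nonneg)

text \<open>
  The defect term of this identity is the source of the strong convexity of the models.
\<close>

lemma norm_convex_combination:
  fixes y z :: "'a::real_inner"
  shows "(norm ((1 - t) *\<^sub>R z + t *\<^sub>R y - xb))\<^sup>2
    = (1 - t) * (norm (z - xb))\<^sup>2 + t * (norm (y - xb))\<^sup>2 - t * (1 - t) * (norm (y - z))\<^sup>2"
  unfolding power2_norm_eq_inner
  by (simp add: inner_diff_left inner_diff_right inner_add_left inner_add_right inner_commute
      algebra_simps)

lemma linearization_convex_combination:
  "linearization f xb ((1 - t) *\<^sub>R z + t *\<^sub>R y)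
    = (1 - t) * linearization f xb z + t * linearization f xb y"
  by (simp add: linearization_def inner_diff_right inner_add_right algebra_simps)

lemma model_val_strongly_convex:
  assumes p: "dc_fun_on S X p" and XS: "X \<subseteq> S" and yz: "y \<in> X" "z \<in> X" and t: "0 \<le> t" "t \<le> 1"
  shows "model_val p jp xb ((1 - t) *\<^sub>R z + t *\<^sub>R y)
    \<le> (1 - t) * model_val p jp xb z + t * model_val p jp xb y
      - Lip p / 2 * (t * (1 - t) * (norm (y - z))\<^sup>2)"
proof -
  have "zeta p ((1 - t) *\<^sub>R z + t *\<^sub>R y) \<le> (1 - t) * zeta p z + t * zeta p y"
    using p XS yz t by (intro convex_onD[of S]) (auto simp: dc_fun_on_def)
  then show ?thesis
    unfolding model_val_def phi_hat_eq_linearization linearization_convex_combination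
      norm_convex_combination
    by (simp add: algebra_simps add_divide_distrib diff_divide_distrib)
qed

lemma model_val_convex:
  assumes p: "dc_fun_on S X p" and XS: "X \<subseteq> S" and yz: "y \<in> X" "z \<in> X" and t: "0 \<le> t" "t \<le> 1"
  shows "model_val p jp xb ((1 - t) *\<^sub>R z + t *\<^sub>R y)
    \<le> (1 - t) * model_val p jp xb z + t * model_val p jp xb y"
proof -
  have "0 \<le> Lip p / 2 * (t * (1 - t) * (norm (y - z))\<^sup>2)"
    using Lip_nonneg[OF p] t by simp
  then show ?thesis using model_val_strongly_convex[OF assms, of jp xb] by linarith
qed

lemma psi_max_tendsto:
  assumes "open S" "dc_fun_on S X p" "a \<in> S" "(y \<longlongrightarrow> a) F"
  shows "((\<lambda>m. psi_max p (y m)) \<longlongrightarrow> psi_max p a) F"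
proof -
  have "((\<lambda>m. psi p k (y m)) \<longlongrightarrow> psi p k a) F" if "k \<in> {1..npieces p}" for k
  proof -
    have "isCont (psi p k) a" using assms that C1_on_imp_continuous_on[of S "psi p k"]
      by (auto simp: dc_fun_on_def continuous_on_eq_continuous_at)
    then show ?thesis using assms(4) by (rule isCont_tendsto_compose)
  qed
  moreover have "{1..npieces p} \<noteq> {}" using assms(2) by (auto simp: dc_fun_on_def)
  moreover have "((\<lambda>m. Max ((\<lambda>k. psi p k (y m)) ` K)) \<longlongrightarrow> Max ((\<lambda>k. psi p k a) ` K)) F"
    if "finite K" "K \<noteq> {}" "\<And>k. k \<in> K \<Longrightarrow> ((\<lambda>m. psi p k (y m)) \<longlongrightarrow> psi p k a) F" for K
    using that by (induction K rule: finite_ne_induct) (auto intro!: tendsto_max)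
  ultimately show ?thesis unfolding psi_max_def by blast
qed

lemma dc_val_tendsto:
  assumes "open S" "dc_fun_on S X p" "a \<in> S" "(y \<longlongrightarrow> a) F"
  shows "((\<lambda>m. dc_val p (y m)) \<longlongrightarrow> dc_val p a) F"
proof -
  have "isCont (phi p) a" "isCont (zeta p) a"
    using assms C1_on_imp_continuous_on[of S "phi p"]
    by (auto simp: dc_fun_on_def continuous_on_eq_continuous_at)
  then show ?thesis unfolding dc_val_def using assms
    by (intro tendsto_intros psi_max_tendsto isCont_tendsto_compose[where g = "phi p"]
        isCont_tendsto_compose[where g = "zeta p"])
qed

lemma model_val_at_base:
  "jp \<in> active_pieces p a \<Longrightarrow> model_val p jp a a = dc_val p a"
  by (simp add: model_val_def phi_hat_def linearization_def dc_val_def active_pieces_def)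

text \<open>
  This is what makes the approximate minimality of the iterates available for a fixed selection of
  pieces that is active only in the limit.
\<close>

lemma eventually_eps_active:
  assumes "open S" "dc_fun_on S X p" "a \<in> S" "(y \<longlongrightarrow> a) F" "jp \<in> active_pieces p a" "\<epsilon> > 0"
  shows "\<forall>\<^sub>F m in F. jp \<in> eps_active_pieces \<epsilon> p (y m)"
proof -
  have jp: "jp \<in> {1..npieces p}" "psi_max p a = psi p jp a"
    using assms(5) by (auto simp: active_pieces_def)
  have "isCont (psi p jp) a" using assms(1-3) jp C1_on_imp_continuous_on[of S "psi p jp"]
    by (auto simp: dc_fun_on_def continuous_on_eq_continuous_at)
  then have "((\<lambda>m. psi_max p (y m) - psi p jp (y m)) \<longlongrightarrow> psi_max p a - psi p jp a) F"
    using assms(1-4) by (intro tendsto_intros psi_max_tendsto isCont_tendsto_compose[of a "psi p jp"])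
  then have "\<forall>\<^sub>F m in F. psi_max p (y m) - psi p jp (y m) < \<epsilon>"
    using jp assms(6) by (intro order_tendstoD) auto
  then show ?thesis by eventually_elim (use jp in \<open>auto simp: eps_active_pieces_def\<close>)
qed

section \<open>Slater points of the convex models\<close>

text \<open>
  The constraint qualification is a statement about directional derivatives at \<open>a\<close>. It is used only
  through Slater points of the convex models based at \<open>a\<close>, and these exist arbitrarily close to \<open>a\<close>. They
  are taken from a sequence \<open>u k = a + \<tau> k * e k\<close> in \<open>X\<close> with \<open>e k\<close> tending to the tangent direction \<open>d\<close>.
\<close>

lemma PSCQ_imp_Slater_points:
  fixes P :: "'i::finite \<Rightarrow> 'a::euclidean_space dc_fun"
  assumes S: "open S" and XS: "X \<subseteq> S" and P: "\<And>i. dc_fun_on S X (P i)"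
    and feas: "a \<in> feasible_set X P" and pscq: "PSCQ X P a"
    and j: "j \<in> active_selections P a" and U: "open U" "a \<in> U"
  shows "\<exists>y\<in>X. y \<in> U \<and> (\<forall>i. model_val (P i) (j i) a y < 0)"
proof -
  have aX: "a \<in> X" and aS: "a \<in> S" and le0: "\<And>i. dc_val (P i) a \<le> 0"
    using feas XS by (auto simp: feasible_set_def)
  have act: "j i \<in> active_pieces (P i) a" for i using j by (auto simp: active_selections_def)
  then have jn: "j i \<in> {1..npieces (P i)}" for i by (auto simp: active_pieces_def)
  obtain d where d: "d \<in> tangent_cone X a" and neg: "\<And>i. i \<in> active_constraints P a \<Longrightarrow>
      grad (phi (P i)) a \<bullet> d + dirderiv (zeta (P i)) a d - grad (psi (P i) (j i)) a \<bullet> d < 0"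
    using pscq j unfolding PSCQ_def by blast
  obtain u \<tau> where u: "\<And>k. u k \<in> X" "u \<longlonglongrightarrow> a" and \<tau>: "\<And>k. \<tau> k > 0" "\<tau> \<longlonglongrightarrow> 0"
    and quot: "(\<lambda>k. (u k - a) /\<^sub>R \<tau> k) \<longlonglongrightarrow> d"
    using d unfolding tangent_cone_def by blast
  define e where "e k = (u k - a) /\<^sub>R \<tau> k" for k
  have e: "e \<longlonglongrightarrow> d" using quot by (simp add: e_def[abs_def])
  have ue: "u k = a + \<tau> k *\<^sub>R e k" for k using \<tau>(1)[of k] by (simp add: e_def)
  have "\<forall>\<^sub>F k in sequentially. model_val (P i) (j i) a (u k) < 0" for i
  proof (cases "i \<in> active_constraints P a")
    case False
    then have "model_val (P i) (j i) a a < 0"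
      using le0[of i] model_val_at_base[OF act[of i]] by (simp add: active_constraints_def)
    moreover have "(\<lambda>k. model_val (P i) (j i) a (u k)) \<longlonglongrightarrow> model_val (P i) (j i) a a"
      by (rule model_val_tendsto[OF S P jn aS aS _ u(2)]) simp
    ultimately show ?thesis by (intro order_tendstoD(2))
  next
    case True
    let ?f = "zeta (P i)" and ?g = "grad (phi (P i)) a - grad (psi (P i) (j i)) a"
    have f: "convex_on S ?f" "continuous_on S ?f" using P[of i] by (auto simp: dc_fun_on_def)
    have "dirderiv ?f a d < - (?g \<bullet> d)" using neg[OF True] by (simp add: inner_diff_left)
    from dirderiv_less_imp_quotient_less[OF S f(1) aS this]
    obtain t where t: "t > 0" "a + t *\<^sub>R d \<in> S" "(?f (a + t *\<^sub>R d) - ?f a) / t < - (?g \<bullet> d)"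
      by blast
    \<comment> \<open>At the base point an active model vanishes, so only the increment towards \<open>u k\<close> matters.\<close>
    have base: "phi (P i) a + ?f a - psi (P i) (j i) a = 0"
      using model_val_at_base[OF act[of i]] True
      by (simp add: active_constraints_def model_val_def phi_hat_def linearization_def)
    \<comment> \<open>By convexity, the quotient of \<open>zeta\<close> along \<open>e k\<close> with the small step \<open>\<tau> k\<close> is at most the quotient
      with the fixed step \<open>t\<close>, which depends continuously on \<open>e k\<close>; thus \<open>h k\<close> bounds the model at \<open>u k\<close>,
      divided by \<open>\<tau> k\<close>.\<close>
    define h where "h k = ?g \<bullet> e k + (?f (a + t *\<^sub>R e k) - ?f a) / t
      + Lip (P i) / 2 * \<tau> k * (norm (e k))\<^sup>2" for k
    have "isCont ?f (a + t *\<^sub>R d)" using f(2) t(2) S by (simp add: continuous_on_eq_continuous_at)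
    then have "(\<lambda>k. ?f (a + t *\<^sub>R e k)) \<longlonglongrightarrow> ?f (a + t *\<^sub>R d)"
      using e by (intro isCont_tendsto_compose[where g = ?f] tendsto_intros)
    then have "h \<longlonglongrightarrow> ?g \<bullet> d + (?f (a + t *\<^sub>R d) - ?f a) / t + Lip (P i) / 2 * 0 * (norm d)\<^sup>2"
      unfolding h_def using e \<tau>(2) t(1) by (intro tendsto_intros) auto
    then have "\<forall>\<^sub>F k in sequentially. h k < 0" using t(3) by (intro order_tendstoD) auto
    moreover have "\<forall>\<^sub>F k in sequentially. \<tau> k < t" using \<tau>(2) t(1) by (intro order_tendstoD)
    moreover have "\<forall>\<^sub>F k in sequentially. a + t *\<^sub>R e k \<in> S"
    proof (rule topological_tendstoD[OF _ S t(2)])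
      show "(\<lambda>k. a + t *\<^sub>R e k) \<longlonglongrightarrow> a + t *\<^sub>R d" using e by (intro tendsto_intros)
    qed
    ultimately show ?thesis
    proof eventually_elim
      case (elim k)
      let ?s = "\<tau> k / t"
      have comb: "(1 - ?s) *\<^sub>R a + ?s *\<^sub>R (a + t *\<^sub>R e k) = u k"
        using t(1) by (simp add: ue algebra_simps)
      have "?f ((1 - ?s) *\<^sub>R a + ?s *\<^sub>R (a + t *\<^sub>R e k)) \<le> (1 - ?s) * ?f a + ?s * ?f (a + t *\<^sub>R e k)"
        using elim \<tau>(1)[of k] t(1) aS by (intro convex_onD[OF f(1)]) auto
      then have "?f (u k) \<le> ?f a + \<tau> k * ((?f (a + t *\<^sub>R e k) - ?f a) / t)"
        unfolding comb by (simp add: algebra_simps diff_divide_distrib)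
      moreover have "model_val (P i) (j i) a (u k) = (phi (P i) a + ?f a - psi (P i) (j i) a)
          + \<tau> k * (?g \<bullet> e k) + Lip (P i) / 2 * (\<tau> k)\<^sup>2 * (norm (e k))\<^sup>2 + (?f (u k) - ?f a)"
        by (simp add: model_val_def phi_hat_def linearization_def ue inner_diff_left power_mult_distrib
            algebra_simps)
      ultimately have "model_val (P i) (j i) a (u k) \<le> \<tau> k * h k"
        unfolding base h_def by (simp add: algebra_simps power2_eq_square)
      also have "\<dots> < 0" using elim \<tau>(1)[of k] by (simp add: mult_pos_neg)
      finally show ?case .
    qed
  qed
  then have "\<forall>\<^sub>F k in sequentially. \<forall>i. model_val (P i) (j i) a (u k) < 0"
    by (rule eventually_all_finite)
  moreover have "\<forall>\<^sub>F k in sequentially. u k \<in> U" using topological_tendstoD[OF u(2) U] .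
  ultimately have "\<forall>\<^sub>F k in sequentially. u k \<in> U \<and> (\<forall>i. model_val (P i) (j i) a (u k) < 0)"
    by eventually_elim auto
  then obtain k where "u k \<in> U \<and> (\<forall>i. model_val (P i) (j i) a (u k) < 0)"
    using eventually_happens'[OF sequentially_bot] by blast
  then show ?thesis using u(1)[of k] by blast
qed

section \<open>The penalty term\<close>

text \<open>
  The square of the positive part has a Lipschitz derivative and is nondecreasing, so it lies below a
  quadratic expansion even if the actual argument \<open>c\<close> is only bounded above by the argument \<open>b\<close> of the
  expansion.
\<close>

lemma positive_part_square_le:
  fixes a b c :: real
  assumes "c \<le> b"
  shows "(max c 0)\<^sup>2 \<le> (max a 0)\<^sup>2 + 2 * max a 0 * (b - a) + (b - a)\<^sup>2"
proof -
  have "(max c 0)\<^sup>2 \<le> (max b 0)\<^sup>2" using assms by (intro power_mono) auto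
  also have "\<dots> \<le> (max a 0)\<^sup>2 + 2 * max a 0 * (b - a) + (b - a)\<^sup>2"
  proof (cases "a \<ge> 0")
    case True
    then have "(max a 0)\<^sup>2 + 2 * max a 0 * (b - a) + (b - a)\<^sup>2 = b\<^sup>2"
      by (simp add: power2_eq_square algebra_simps)
    moreover have "(max b 0)\<^sup>2 \<le> b\<^sup>2" by (simp add: max_def)
    ultimately show ?thesis by simp
  next
    case False
    then have "(max b 0)\<^sup>2 \<le> (b - a)\<^sup>2" by (simp add: max_def power_mono)
    then show ?thesis using False by (simp add: max_def)
  qed
  finally show ?thesis .
qed

text \<open>
  The lower bound below is attained exactly when every constraint term is switched off. Since the same
  constant enters the augmented Lagrangian and its model, it cancels whenever the two are compared.
\<close>

lemma AL_penalty_ge: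
  assumes "\<rho> > 0"
  shows "- (1 / (2 * \<rho>)) * (\<Sum>i\<in>UNIV. (lam $ i)\<^sup>2) \<le> AL_penalty \<rho> lam c"
proof -
  have "(\<Sum>i\<in>UNIV. - (lam $ i)\<^sup>2) \<le> (\<Sum>i\<in>UNIV. (max (lam $ i + \<rho> * c i) 0)\<^sup>2 - (lam $ i)\<^sup>2)"
    by (intro sum_mono) simp
  then have "1 / (2 * \<rho>) * (\<Sum>i\<in>UNIV. - (lam $ i)\<^sup>2) \<le> AL_penalty \<rho> lam c"
    unfolding AL_penalty_def using assms by (intro mult_left_mono) auto
  then show ?thesis by (simp add: sum_negf)
qed

lemma AL_penalty_eq:
  assumes "\<And>i. lam $ i + \<rho> * c i \<le> 0"
  shows "AL_penalty \<rho> lam c = - (1 / (2 * \<rho>)) * (\<Sum>i\<in>UNIV. (lam $ i)\<^sup>2)"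
  using assms by (simp add: AL_penalty_def max_def sum_negf)

lemma AL_penalty_diff_le:
  assumes \<rho>: "\<rho> > 0" and le: "\<And>i. c' i \<le> c i + t * \<Delta> i"
  shows "AL_penalty \<rho> lam c' - AL_penalty \<rho> lam c
    \<le> (\<Sum>i\<in>UNIV. max (lam $ i + \<rho> * c i) 0 * (t * \<Delta> i)) + t\<^sup>2 * (\<rho> / 2 * (\<Sum>i\<in>UNIV. (\<Delta> i)\<^sup>2))"
proof -
  have "AL_penalty \<rho> lam c' - AL_penalty \<rho> lam c = 1 / (2 * \<rho>) *
      (\<Sum>i\<in>UNIV. (max (lam $ i + \<rho> * c' i) 0)\<^sup>2 - (max (lam $ i + \<rho> * c i) 0)\<^sup>2)"
    unfolding AL_penalty_def right_diff_distrib[symmetric] sum_subtractf[symmetric] by simp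
  also have "\<dots> \<le> 1 / (2 * \<rho>) * (\<Sum>i\<in>UNIV. 2 * max (lam $ i + \<rho> * c i) 0 * (\<rho> * (t * \<Delta> i))
      + (\<rho> * (t * \<Delta> i))\<^sup>2)"
  proof (intro mult_left_mono sum_mono)
    fix i
    have "lam $ i + \<rho> * c' i \<le> lam $ i + \<rho> * (c i + t * \<Delta> i)" using le[of i] \<rho> by simp
    from positive_part_square_le[OF this, of "lam $ i + \<rho> * c i"]
    show "(max (lam $ i + \<rho> * c' i) 0)\<^sup>2 - (max (lam $ i + \<rho> * c i) 0)\<^sup>2
        \<le> 2 * max (lam $ i + \<rho> * c i) 0 * (\<rho> * (t * \<Delta> i)) + (\<rho> * (t * \<Delta> i))\<^sup>2"
      by (simp add: distrib_left)
  qed (use \<rho> in simp)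
  also have "\<dots> = (\<Sum>i\<in>UNIV. max (lam $ i + \<rho> * c i) 0 * (t * \<Delta> i)
      + t\<^sup>2 * (\<rho> / 2 * (\<Delta> i)\<^sup>2))"
    unfolding sum_distrib_left using \<rho> by (intro sum.cong) (auto simp: field_simps power2_eq_square)
  also have "\<dots> = (\<Sum>i\<in>UNIV. max (lam $ i + \<rho> * c i) 0 * (t * \<Delta> i))
      + t\<^sup>2 * (\<rho> / 2 * (\<Sum>i\<in>UNIV. (\<Delta> i)\<^sup>2))"
    by (simp add: sum.distrib sum_distrib_left)
  finally show ?thesis .
qed

text \<open>
  Divide by \<open>t\<close> and let \<open>t\<close> tend to zero.
\<close>

lemma le_of_le_add_small:
  fixes a b c :: real
  assumes "\<And>t. 0 < t \<Longrightarrow> t \<le> 1 \<Longrightarrow> t * a \<le> t * b + t\<^sup>2 * c"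
  shows "a \<le> b"
proof (rule tendsto_lowerbound)
  show "((\<lambda>t. b + t * c) \<longlongrightarrow> b) (at_right 0)"
    by (rule tendsto_eq_intros refl tendsto_ident_at | simp)+
  have "\<forall>\<^sub>F t in at_right (0::real). 0 < t \<and> t < 1"
    using eventually_at_right_real[of 0 1] by (auto elim: eventually_mono)
  then show "\<forall>\<^sub>F t in at_right 0. a \<le> b + t * c"
  proof eventually_elim
    case (elim t)
    then have "t * a \<le> t * (b + t * c)" using assms[of t] by (simp add: algebra_simps power2_eq_square)
    then show ?case using elim by simp
  qed
qed simp

text \<open>
  A subgradient of the penalized model is a subgradient of the ordinary Lagrangian of the model, taken
  with the updated multipliers. Along the segment from \<open>z\<close> to \<open>y\<close> the penalty grows at most by the
  multipliers times the increments of the constraints, up to a term of second order in the step; the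
  first-order part of the inequality remains when the step tends to zero. The objective model
  contributes its modulus of strong convexity.
\<close>

lemma Lagrangian_inequality_of_subgradient:
  fixes P :: "'i::finite \<Rightarrow> 'a::real_inner dc_fun"
  assumes P0: "dc_fun_on S X P0" and P: "\<And>i. dc_fun_on S X (P i)"
    and XS: "X \<subseteq> S" and X: "convex X" and \<rho>: "\<rho> > 0"
    and z: "z \<in> X" and y: "y \<in> X"
    and sub: "\<And>y. y \<in> X \<Longrightarrow> Q_AL P0 P \<rho> z xb lam j0 j + v \<bullet> (y - z) \<le> Q_AL P0 P \<rho> y xb lam j0 j"
    and \<mu>: "\<mu> = model_multiplier P \<rho> z xb lam j"
  shows "model_val P0 j0 xb z + (\<Sum>i\<in>UNIV. \<mu> $ i * model_val (P i) (j i) xb z)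
      + v \<bullet> (y - z) + Lip P0 / 2 * (norm (y - z))\<^sup>2
    \<le> model_val P0 j0 xb y + (\<Sum>i\<in>UNIV. \<mu> $ i * model_val (P i) (j i) xb y)"
proof -
  define N where "N = Lip P0 / 2 * (norm (y - z))\<^sup>2"
  define \<Delta> where "\<Delta> i = model_val (P i) (j i) xb y - model_val (P i) (j i) xb z" for i
  define \<Delta>0 where "\<Delta>0 = model_val P0 j0 xb y - model_val P0 j0 xb z"
  have "v \<bullet> (y - z) \<le> \<Delta>0 - N + (\<Sum>i\<in>UNIV. \<mu> $ i * \<Delta> i)"
  proof (rule le_of_le_add_small)
    fix t :: real assume t: "0 < t" "t \<le> 1"
    let ?y = "(1 - t) *\<^sub>R z + t *\<^sub>R y"
    have yX: "?y \<in> X" using X z y t by (simp add: convex_alt)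
    have "model_val P0 j0 xb ?y \<le> model_val P0 j0 xb z + t * \<Delta>0 - t * (1 - t) * N"
      using model_val_strongly_convex[OF P0 XS y z, of t j0 xb] t
      by (simp add: \<Delta>0_def N_def algebra_simps add_divide_distrib diff_divide_distrib)
    moreover have "AL_penalty \<rho> lam (\<lambda>i. model_val (P i) (j i) xb ?y)
        - AL_penalty \<rho> lam (\<lambda>i. model_val (P i) (j i) xb z)
      \<le> (\<Sum>i\<in>UNIV. max (lam $ i + \<rho> * model_val (P i) (j i) xb z) 0 * (t * \<Delta> i))
        + t\<^sup>2 * (\<rho> / 2 * (\<Sum>i\<in>UNIV. (\<Delta> i)\<^sup>2))"
    proof (rule AL_penalty_diff_le[OF \<rho>])
      fix i
      show "model_val (P i) (j i) xb ?y \<le> model_val (P i) (j i) xb z + t * \<Delta> i"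
        using model_val_convex[OF P[of i] XS y z, of t "j i" xb] t by (simp add: \<Delta>_def algebra_simps)
    qed
    moreover have "(\<Sum>i\<in>UNIV. max (lam $ i + \<rho> * model_val (P i) (j i) xb z) 0 * (t * \<Delta> i))
        = t * (\<Sum>i\<in>UNIV. \<mu> $ i * \<Delta> i)"
      unfolding sum_distrib_left by (intro sum.cong) (auto simp: \<mu> model_multiplier_def)
    moreover have "v \<bullet> (?y - z) = t * (v \<bullet> (y - z))"
      by (simp add: inner_diff_right inner_add_right algebra_simps)
    moreover note sub[OF yX]
    ultimately show "t * (v \<bullet> (y - z)) \<le> t * (\<Delta>0 - N + (\<Sum>i\<in>UNIV. \<mu> $ i * \<Delta> i))
        + t\<^sup>2 * (N + \<rho> / 2 * (\<Sum>i\<in>UNIV. (\<Delta> i)\<^sup>2))"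
      by (simp add: Q_AL_def algebra_simps power2_eq_square)
  qed
  then show ?thesis
    by (simp add: N_def \<Delta>_def \<Delta>0_def sum_subtractf algebra_simps)
qed

section \<open>Convergence of the solutions of the model subproblems\<close>

text \<open>
  Completion of the square.
\<close>

lemma inner_quadratic_bound:
  fixes b d :: "'a::real_inner"
  assumes "L > 0"
  shows "- (b \<bullet> d) - L / 2 * (norm d)\<^sup>2 \<le> (norm b)\<^sup>2 / (2 * L)"
proof -
  have "0 \<le> (b + L *\<^sub>R d) \<bullet> (b + L *\<^sub>R d)" by (rule inner_ge_zero)
  also have "\<dots> = (norm b)\<^sup>2 + 2 * L * (b \<bullet> d) + L\<^sup>2 * (norm d)\<^sup>2"
    unfolding power2_norm_eq_inner
    by (simp add: inner_add_left inner_add_right inner_commute algebra_simps power2_eq_square)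
  finally show ?thesis using assms by (simp add: field_simps power2_eq_square)
qed

text \<open>
  The situation of the theorem after passing to the subsequence: \<open>x\<close> are the iterates converging to \<open>a\<close>,
  \<open>z\<close> the approximate solutions of the model problems, \<open>v\<close> small subgradients that witness their
  approximate stationarity, and \<open>\<mu>\<close> the updated multipliers. The update rules for multipliers and
  penalty enter only through \<open>\<rho>_pos\<close>, \<open>\<rho>_lim\<close>, \<open>lam_nonneg\<close> and \<open>lam_\<rho>\<close>.
\<close>

locale model_subproblems =
  fixes S X :: "'a::euclidean_space set" and P0 :: "'a dc_fun" and P :: "'i::finite \<Rightarrow> 'a dc_fun"
    and a :: 'a and j0 :: nat and j :: "'i \<Rightarrow> nat"
    and x z v :: "nat \<Rightarrow> 'a" and lam \<mu> :: "nat \<Rightarrow> real ^ 'i" and \<rho> \<eta> :: "nat \<Rightarrow> real"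
  assumes program: "dc_program S X P0 P"
    and feasible: "a \<in> feasible_set X P" and pscq: "PSCQ X P a"
    and j0: "j0 \<in> active_pieces P0 a" and j: "j \<in> active_selections P a"
    and \<rho>_pos: "\<And>m. \<rho> m > 0" and \<rho>_lim: "filterlim \<rho> at_top sequentially"
    and lam_nonneg: "\<And>m i. lam m $ i \<ge> 0" and lam_\<rho>: "\<And>i. (\<lambda>m. lam m $ i / \<rho> m) \<longlonglongrightarrow> 0"
    and x_lim: "x \<longlonglongrightarrow> a" and z_in: "\<And>m. z m \<in> X"
    and v_lim: "v \<longlonglongrightarrow> 0" and \<eta>_lim: "\<eta> \<longlonglongrightarrow> 0"
    and near_optimal: "\<forall>\<^sub>F m in sequentially. \<forall>y\<in>X.
      F_AL P0 P (\<rho> m) (x m) (lam m) \<le> Q_AL P0 P (\<rho> m) y (x m) (lam m) j0 j + \<eta> m"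
    and subgradient: "\<And>m y. y \<in> X \<Longrightarrow> Q_AL P0 P (\<rho> m) (z m) (x m) (lam m) j0 j + v m \<bullet> (y - z m)
      \<le> Q_AL P0 P (\<rho> m) y (x m) (lam m) j0 j"
    and \<mu>: "\<And>m. \<mu> m = model_multiplier P (\<rho> m) (z m) (x m) (lam m) j"
begin

abbreviation c0 where "c0 m y \<equiv> model_val P0 j0 (x m) y"
abbreviation c where "c i m y \<equiv> model_val (P i) (j i) (x m) y"

lemma S: "open S" and X: "convex X" and XS: "X \<subseteq> S" and P0: "dc_fun_on S X P0"
  and P: "dc_fun_on S X (P i)" and L0: "Lip P0 > 0"
  using program by (auto simp: dc_program_def)

lemma a_in: "a \<in> X" "a \<in> S" using feasible XS by (auto simp: feasible_set_def)

lemma active: "j i \<in> active_pieces (P i) a" using j by (auto simp: active_selections_def)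

lemma pieces: "j0 \<in> {1..npieces P0}" "j i \<in> {1..npieces (P i)}"
  using j0 active[of i] by (auto simp: active_pieces_def)

lemma c0_tendsto: "b \<in> S \<Longrightarrow> y \<longlonglongrightarrow> b \<Longrightarrow> (\<lambda>m. c0 m (y m)) \<longlonglongrightarrow> model_val P0 j0 a b"
  using model_val_tendsto[OF S P0 pieces(1) a_in(2) _ x_lim] .

lemma c_tendsto: "b \<in> S \<Longrightarrow> y \<longlonglongrightarrow> b \<Longrightarrow> (\<lambda>m. c i m (y m)) \<longlonglongrightarrow> model_val (P i) (j i) a b"
  using model_val_tendsto[OF S P pieces(2) a_in(2) _ x_lim] .

lemma \<mu>_nth: "\<mu> m $ i = max (lam m $ i + \<rho> m * c i m (z m)) 0"
  by (simp add: \<mu> model_multiplier_def)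

lemma \<mu>_nonneg: "0 \<le> \<mu> m $ i" by (simp add: \<mu>_nth)

lemma Lagrangian_inequality:
  assumes "y \<in> X"
  shows "c0 m (z m) + (\<Sum>i\<in>UNIV. \<mu> m $ i * c i m (z m)) + v m \<bullet> (y - z m)
      + Lip P0 / 2 * (norm (y - z m))\<^sup>2 \<le> c0 m y + (\<Sum>i\<in>UNIV. \<mu> m $ i * c i m y)"
  using Lagrangian_inequality_of_subgradient[OF P0 P XS X \<rho>_pos z_in assms subgradient \<mu>] .

text \<open>
  A Slater point of the limiting models stays one for the models at the iterates, with a margin that
  dominates the shift of the penalty terms by the old multipliers.
\<close>

lemma Slater_margin:
  assumes y: "y \<in> X" and neg: "\<And>i. model_val (P i) (j i) a y < 0"
  shows "\<exists>\<delta>>0. \<forall>\<^sub>F m in sequentially. \<forall>i. c i m y \<le> - \<delta> \<and> lam m $ i / \<rho> m \<le> \<delta> / 4"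
proof -
  define \<delta> where "\<delta> = Min (range (\<lambda>i. - model_val (P i) (j i) a y / 2))"
  have \<delta>: "\<delta> > 0" using neg by (auto simp: \<delta>_def)
  have "\<forall>\<^sub>F m in sequentially. c i m y \<le> - \<delta> \<and> lam m $ i / \<rho> m \<le> \<delta> / 4" for i
  proof -
    have "\<delta> \<le> - model_val (P i) (j i) a y / 2" unfolding \<delta>_def by (intro Min_le) auto
    then have "model_val (P i) (j i) a y < - \<delta>" using neg[of i] by linarith
    then have "\<forall>\<^sub>F m in sequentially. c i m y < - \<delta>"
      using y XS by (intro order_tendstoD(2)[OF c_tendsto[of y "\<lambda>_. y"]]) auto
    moreover have "\<forall>\<^sub>F m in sequentially. lam m $ i / \<rho> m < \<delta> / 4"
      using \<delta> by (intro order_tendstoD(2)[OF lam_\<rho>]) simp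
    ultimately show ?thesis by eventually_elim auto
  qed
  then have "\<forall>\<^sub>F m in sequentially. \<forall>i. c i m y \<le> - \<delta> \<and> lam m $ i / \<rho> m \<le> \<delta> / 4"
    by (rule eventually_all_finite)
  with \<delta> show ?thesis by blast
qed

text \<open>
  The Lagrangian inequality evaluated at a Slater point. A positive multiplier forces its constraint at
  \<open>z m\<close> to be at least \<open>- lam / \<rho>\<close>, so it pays for the margin \<open>\<delta>\<close> of the Slater point.
\<close>

lemma multiplier_estimate:
  assumes y: "y \<in> X" and \<delta>: "\<delta> > 0"
    and margin: "\<And>i. c i m y \<le> - \<delta> \<and> lam m $ i / \<rho> m \<le> \<delta> / 4"
  shows "\<delta> / 2 * (\<Sum>i\<in>UNIV. \<mu> m $ i) + c0 m (z m) + v m \<bullet> (y - z m)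
      + Lip P0 / 2 * (norm (y - z m))\<^sup>2 \<le> c0 m y"
proof -
  have "\<delta> / 2 * \<mu> m $ i \<le> \<mu> m $ i * c i m (z m) - \<mu> m $ i * c i m y" for i
  proof (cases "\<mu> m $ i = 0")
    case False
    then have "lam m $ i + \<rho> m * c i m (z m) > 0" by (auto simp: \<mu>_nth max_def split: if_splits)
    then have "c i m (z m) > - (lam m $ i / \<rho> m)" using \<rho>_pos[of m] by (simp add: field_simps)
    then have "\<delta> / 2 \<le> c i m (z m) - c i m y" using margin[of i] \<delta> by linarith
    from mult_left_mono[OF this \<mu>_nonneg[of m i]] show ?thesis by (simp add: algebra_simps)
  qed simp
  then have "(\<Sum>i\<in>UNIV. \<delta> / 2 * \<mu> m $ i)
      \<le> (\<Sum>i\<in>UNIV. \<mu> m $ i * c i m (z m)) - (\<Sum>i\<in>UNIV. \<mu> m $ i * c i m y)"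
    unfolding sum_subtractf[symmetric] by (rule sum_mono)
  then show ?thesis using Lagrangian_inequality[OF y, of m] by (simp add: sum_distrib_left)
qed

text \<open>
  In the estimate above the only term that could compensate large multipliers is the objective model
  at \<open>z m\<close>. It is bounded below by an affine function of \<open>z m\<close> with convergent coefficients, and the
  quadratic term from strong convexity absorbs the linear growth. In this way no bound on \<open>z\<close> is needed
  in advance.
\<close>

lemma multipliers_eventually_bounded: "\<exists>M. \<forall>\<^sub>F m in sequentially. (\<Sum>i\<in>UNIV. \<mu> m $ i) \<le> M"
proof -
  obtain y where y: "y \<in> X" "\<And>i. model_val (P i) (j i) a y < 0"
    using PSCQ_imp_Slater_points[OF S XS P feasible pscq j open_UNIV UNIV_I] by blast
  obtain \<delta> where \<delta>: "\<delta> > 0"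
    and margin: "\<forall>\<^sub>F m in sequentially. \<forall>i. c i m y \<le> - \<delta> \<and> lam m $ i / \<rho> m \<le> \<delta> / 4"
    using Slater_margin[OF y] by blast
  have \<zeta>: "convex_on S (zeta P0)" and C1: "C1_on S (phi P0)" "C1_on S (psi P0 j0)"
    using P0 pieces(1) by (auto simp: dc_fun_on_def)
  obtain w where w: "\<And>b. b \<in> S \<Longrightarrow> zeta P0 a + w \<bullet> (b - a) \<le> zeta P0 b"
    using subgradient_exists[OF S \<zeta> a_in(2)] by blast
  define A where "A m = linearization (phi P0) (x m) y - linearization (psi P0 j0) (x m) y
    + zeta P0 a + w \<bullet> (y - a)" for m
  define B where "B m = grad (phi P0) (x m) - grad (psi P0 j0) (x m) + w" for m
  have lower: "A m + B m \<bullet> (z m - y) \<le> c0 m (z m)" for m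
  proof -
    have "0 \<le> Lip P0 / 2 * (norm (z m - x m))\<^sup>2" using L0 by simp
    moreover have "zeta P0 a + w \<bullet> (z m - a) \<le> zeta P0 (z m)" using w z_in XS by blast
    ultimately show ?thesis
      by (simp add: A_def B_def model_val_def phi_hat_def linearization_def inner_diff_left
          inner_diff_right inner_add_left algebra_simps)
  qed
  define R where "R m = c0 m y - A m + (norm (B m - v m))\<^sup>2 / (2 * Lip P0)" for m
  have "isCont (grad (phi P0)) a" "isCont (grad (psi P0 j0)) a"
    using C1 S a_in by (auto simp: C1_on_def continuous_on_eq_continuous_at)
  then have "(\<lambda>m. grad (phi P0) (x m)) \<longlonglongrightarrow> grad (phi P0) a"
    "(\<lambda>m. grad (psi P0 j0) (x m)) \<longlonglongrightarrow> grad (psi P0 j0) a"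
    using x_lim by (auto intro: isCont_tendsto_compose)
  then have "B \<longlonglongrightarrow> grad (phi P0) a - grad (psi P0 j0) a + w" (is "B \<longlonglongrightarrow> ?B")
    unfolding B_def by (intro tendsto_intros)
  moreover have "A \<longlonglongrightarrow> linearization (phi P0) a y - linearization (psi P0 j0) a y
    + zeta P0 a + w \<bullet> (y - a)" (is "A \<longlonglongrightarrow> ?A")
    unfolding A_def using x_lim
    by (intro tendsto_intros C1_on_linearization_tendsto[OF S _ a_in(2)] C1)
  moreover have "(\<lambda>m. c0 m y) \<longlonglongrightarrow> model_val P0 j0 a y" using y XS by (intro c0_tendsto) auto
  ultimately have "R \<longlonglongrightarrow> model_val P0 j0 a y - ?A + (norm (?B - 0))\<^sup>2 / (2 * Lip P0)"
    unfolding R_def using v_lim L0 by (intro tendsto_intros) auto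
  from Bseq_eq_bounded[THEN iffD1, OF convergent_imp_Bseq[OF convergentI[OF this]]]
  obtain K where K: "\<And>m. \<bar>R m\<bar> \<le> K" by (auto simp: bounded_iff)
  from margin have "\<forall>\<^sub>F m in sequentially. (\<Sum>i\<in>UNIV. \<mu> m $ i) \<le> 2 * K / \<delta>"
  proof eventually_elim
    case (elim m)
    have "\<delta> / 2 * (\<Sum>i\<in>UNIV. \<mu> m $ i) + c0 m (z m) + v m \<bullet> (y - z m)
      + Lip P0 / 2 * (norm (y - z m))\<^sup>2 \<le> c0 m y"
      using multiplier_estimate[OF y(1) \<delta>, of m] elim by blast
    moreover have "- ((B m - v m) \<bullet> (z m - y)) - Lip P0 / 2 * (norm (z m - y))\<^sup>2
        \<le> (norm (B m - v m))\<^sup>2 / (2 * Lip P0)" by (rule inner_quadratic_bound[OF L0])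
    moreover have "(B m - v m) \<bullet> (z m - y) = B m \<bullet> (z m - y) + v m \<bullet> (y - z m)"
      by (simp add: inner_diff_left inner_diff_right)
    ultimately have "\<delta> / 2 * (\<Sum>i\<in>UNIV. \<mu> m $ i) \<le> R m"
      using lower[of m] by (simp add: R_def norm_minus_commute)
    also have "\<dots> \<le> K" using K[of m] by simp
    finally show ?case using \<delta> by (simp add: field_simps)
  qed
  then show ?thesis by blast
qed

text \<open>
  Compare the midpoint between \<open>z m\<close> and a Slater point \<open>y\<close> with the iterate. As the multipliers are
  bounded and \<open>\<rho>\<close> diverges, the constraint violation at \<open>z m\<close> tends to zero, and the midpoint inherits part of
  the margin of \<open>y\<close>; all penalty terms are off there. Up to vanishing errors, minimality of the iterate then bounds
  the objective at \<open>x m\<close> by the objective model at the midpoint, whereas the estimate for \<open>z m\<close> pushes that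
  value below the one at \<open>y\<close> by a multiple of the squared distance between \<open>y\<close> and \<open>z m\<close>. This distance is therefore
  controlled by the gap between the limiting objective model at \<open>y\<close> and the objective at \<open>a\<close>, which is
  small for \<open>y\<close> near \<open>a\<close>.
\<close>

lemma solutions_tendsto: "z \<longlonglongrightarrow> a"
proof (rule tendstoI)
  fix e :: real assume e: "e > 0"
  \<comment> \<open>The constant makes a gap in the objective force a distance below half of \<open>e\<close>: \<open>gap = (L / 8) * (e / 2)^2\<close>.\<close>
  define gap where "gap = Lip P0 * e\<^sup>2 / 32"
  have gap: "gap > 0" using e L0 by (simp add: gap_def)
  have "((\<lambda>y. model_val P0 j0 a y) \<longlongrightarrow> model_val P0 j0 a a) (nhds a)"
    by (rule model_val_tendsto[OF S P0 pieces(1) a_in(2) a_in(2)]) (auto simp: filterlim_ident)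
  then have "\<forall>\<^sub>F y in nhds a. model_val P0 j0 a y < dc_val P0 a + gap"
    using gap by (intro order_tendstoD(2)) (auto simp: model_val_at_base[OF j0])
  moreover have "\<forall>\<^sub>F y in nhds a. dist y a < e / 2"
    using e by (intro tendstoD[OF filterlim_ident]) simp
  ultimately have "\<forall>\<^sub>F y in nhds a. model_val P0 j0 a y < dc_val P0 a + gap \<and> dist y a < e / 2"
    by eventually_elim simp
  then obtain U where U: "open U" "a \<in> U"
    "\<And>y. y \<in> U \<Longrightarrow> model_val P0 j0 a y < dc_val P0 a + gap \<and> dist y a < e / 2"
    by (auto simp: eventually_nhds)
  obtain y where y: "y \<in> X" "\<And>i. model_val (P i) (j i) a y < 0" and yU: "y \<in> U"
    using PSCQ_imp_Slater_points[OF S XS P feasible pscq j U(1,2)] by blast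
  obtain \<delta> where \<delta>: "\<delta> > 0"
    and margin: "\<forall>\<^sub>F m in sequentially. \<forall>i. c i m y \<le> - \<delta> \<and> lam m $ i / \<rho> m \<le> \<delta> / 4"
    using Slater_margin[OF y] by blast
  obtain M where M: "\<forall>\<^sub>F m in sequentially. (\<Sum>i\<in>UNIV. \<mu> m $ i) \<le> M"
    using multipliers_eventually_bounded by blast
  have big: "\<forall>\<^sub>F m in sequentially. 2 * M / \<delta> \<le> \<rho> m"
    using \<rho>_lim by (simp add: filterlim_at_top)
  define R where "R m = c0 m y - dc_val P0 (x m) + \<eta> m + (norm (v m))\<^sup>2 / (2 * Lip P0)" for m
  have "R \<longlonglongrightarrow> model_val P0 j0 a y - dc_val P0 a + 0 + (norm (0::'a))\<^sup>2 / (2 * Lip P0)"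
    unfolding R_def using y XS L0
    by (intro tendsto_intros c0_tendsto dc_val_tendsto[OF S P0 a_in(2) x_lim] \<eta>_lim v_lim) auto
  then have "\<forall>\<^sub>F m in sequentially. R m < gap" using U(3)[OF yU] by (intro order_tendstoD(2)) auto
  with near_optimal margin M big show "\<forall>\<^sub>F m in sequentially. dist (z m) a < e"
  proof eventually_elim
    case (elim m)
    let ?D = "(norm (y - z m))\<^sup>2"
    define w where "w = (1 - 1/2) *\<^sub>R z m + (1/2) *\<^sub>R y"
    have wX: "w \<in> X" unfolding w_def using X z_in y by (intro convexD_alt) auto
    have off: "lam m $ i + \<rho> m * c i m w \<le> 0" for i
    proof -
      have "\<rho> m * c i m (z m) \<le> \<mu> m $ i" using lam_nonneg[of m i] by (simp add: \<mu>_nth)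
      also have "\<dots> \<le> (\<Sum>i\<in>UNIV. \<mu> m $ i)" by (intro member_le_sum) (auto simp: \<mu>_nonneg)
      also have "\<dots> \<le> \<rho> m * (\<delta> / 2)" using elim \<delta> by (simp add: field_simps)
      finally have "c i m (z m) \<le> \<delta> / 2" using \<rho>_pos[of m] by simp
      moreover have "c i m w \<le> (c i m (z m) + c i m y) / 2"
        using model_val_convex[OF P XS y(1) z_in, of "1/2" i "j i" "x m" m] by (simp add: w_def)
      moreover have "c i m y \<le> - \<delta>" using elim(2) by blast
      ultimately have "c i m w \<le> - \<delta> / 4" by simp
      moreover have "lam m $ i / \<rho> m \<le> \<delta> / 4" using elim(2) by blast
      ultimately have "lam m $ i / \<rho> m + c i m w \<le> \<delta> / 4 + - \<delta> / 4" by (intro add_mono)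
      then show ?thesis using \<rho>_pos[of m] by (simp add: field_simps)
    qed
    have "dc_val P0 (x m) \<le> c0 m w + \<eta> m"
      using elim(1)[rule_format, OF wX] AL_penalty_eq[OF off]
        AL_penalty_ge[OF \<rho>_pos[of m], of "lam m" "\<lambda>i. dc_val (P i) (x m)"]
      by (simp add: F_AL_def Q_AL_def)
    moreover have "c0 m w \<le> (c0 m (z m) + c0 m y) / 2"
      using model_val_convex[OF P0 XS y(1) z_in, of "1/2" j0 "x m" m] by (simp add: w_def)
    moreover have "c0 m (z m) + v m \<bullet> (y - z m) + Lip P0 / 2 * ?D \<le> c0 m y"
    proof -
      have "0 \<le> \<delta> / 2 * (\<Sum>i\<in>UNIV. \<mu> m $ i)" using \<delta> by (simp add: sum_nonneg \<mu>_nonneg)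
      then show ?thesis using multiplier_estimate[OF y(1) \<delta>, of m] elim by fastforce
    qed
    moreover have "- (v m \<bullet> (y - z m)) / 2 - Lip P0 / 8 * ?D \<le> (norm (v m))\<^sup>2 / (2 * Lip P0)"
      using inner_quadratic_bound[of "Lip P0 / 4" "(1/2) *\<^sub>R v m" "y - z m"] L0
      by (simp add: power_divide)
    ultimately have "Lip P0 / 8 * ?D \<le> R m" by (simp add: R_def)
    also have "\<dots> < Lip P0 / 8 * (e / 2)\<^sup>2" using elim by (simp add: gap_def power_divide)
    finally have "?D < (e / 2)\<^sup>2" using L0 by simp
    then have "norm (y - z m) < e / 2" using e by (intro power2_less_imp_less[of _ "e / 2"]) auto
    moreover have "dist (z m) a \<le> norm (y - z m) + dist y a"
      using dist_triangle[of "z m" a y] by (simp add: dist_norm norm_minus_commute)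
    ultimately show ?case using U(3)[OF yU] by linarith
  qed
qed

lemma multipliers_bounded: "bounded (range \<mu>)"
proof -
  obtain M where M: "\<forall>\<^sub>F m in sequentially. (\<Sum>i\<in>UNIV. \<mu> m $ i) \<le> M"
    using multipliers_eventually_bounded by blast
  then have "\<forall>\<^sub>F m in sequentially. norm (\<mu> m) \<le> max M 1"
  proof eventually_elim
    case (elim m)
    have "norm (\<mu> m) \<le> (\<Sum>i\<in>UNIV. \<bar>\<mu> m $ i\<bar>)" by (rule norm_le_l1_cart)
    also have "\<dots> = (\<Sum>i\<in>UNIV. \<mu> m $ i)" by (simp add: \<mu>_nonneg)
    finally show ?case using elim by simp
  qed
  then have "Bseq \<mu>" unfolding Bfun_def by (intro exI[of _ "max M 1"]) auto
  then show ?thesis by (simp add: Bseq_eq_bounded)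
qed

section \<open>Limits of the multipliers\<close>

text \<open>
  The argument of the positive part is \<open>\<rho>\<close> times a quantity with negative limit.
\<close>

lemma inactive_multiplier_eventually_zero:
  assumes "dc_val (P i) a < 0"
  shows "\<forall>\<^sub>F m in sequentially. \<mu> m $ i = 0"
proof -
  have "(\<lambda>m. lam m $ i / \<rho> m + c i m (z m)) \<longlonglongrightarrow> 0 + model_val (P i) (j i) a a"
    by (intro tendsto_intros lam_\<rho> c_tendsto solutions_tendsto a_in)
  then have "\<forall>\<^sub>F m in sequentially. lam m $ i / \<rho> m + c i m (z m) < 0"
    using assms by (intro order_tendstoD(2)) (auto simp: model_val_at_base[OF active])
  then show ?thesis
  proof eventually_elim
    case (elim m)
    then have "lam m $ i + \<rho> m * c i m (z m) < 0" using \<rho>_pos[of m] by (simp add: field_simps)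
    then show ?case by (simp add: \<mu>_nth)
  qed
qed

context
  fixes s :: "nat \<Rightarrow> nat" and L :: "real ^ 'i"
  assumes s: "strict_mono s" and L: "(\<lambda>m. \<mu> (s m)) \<longlonglongrightarrow> L"
begin

lemma L_nth: "(\<lambda>m. \<mu> (s m) $ i) \<longlonglongrightarrow> L $ i"
  using L by (rule tendsto_vec_nth)

lemma limit_multiplier_nonneg: "L $ i \<ge> 0"
  using L_nth by (rule tendsto_lowerbound) (auto simp: \<mu>_nonneg)

lemma complementary_slackness:
  "L $ i * (phi (P i) a + zeta (P i) a - psi (P i) (j i) a) = 0"
proof -
  have eq: "phi (P i) a + zeta (P i) a - psi (P i) (j i) a = dc_val (P i) a"
    using active[of i] by (simp add: dc_val_def active_pieces_def)
  have "dc_val (P i) a \<le> 0" using feasible by (auto simp: feasible_set_def)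
  moreover have "L $ i = 0" if "dc_val (P i) a < 0"
  proof -
    have "\<forall>\<^sub>F m in sequentially. \<mu> (s m) $ i = 0"
      using filterlim_subseq[OF s] inactive_multiplier_eventually_zero[OF that]
      by (rule eventually_compose_filterlim[rotated])
    then have "(\<lambda>m. \<mu> (s m) $ i) \<longlonglongrightarrow> 0" by (rule tendsto_eventually)
    then show ?thesis using LIMSEQ_unique[OF L_nth] by blast
  qed
  ultimately show ?thesis unfolding eq by (cases "dc_val (P i) a = 0") auto
qed

text \<open>
  The subgradient inequality is passed to the limit before any subgradients of the \<open>zeta\<close> functions are
  chosen, so that no sequence of subgradients has to be bounded.
\<close>

lemma limit_minimizes_model_Lagrangian:
  assumes y: "y \<in> X"
  shows "model_val P0 j0 a a + (\<Sum>i\<in>UNIV. L $ i * model_val (P i) (j i) a a)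
    \<le> model_val P0 j0 a y + (\<Sum>i\<in>UNIV. L $ i * model_val (P i) (j i) a y)"
proof -
  note sub = LIMSEQ_subseq_LIMSEQ[OF _ s, unfolded o_def]
  have zs: "(\<lambda>m. z (s m)) \<longlonglongrightarrow> a" by (rule sub[OF solutions_tendsto])
  have "(\<lambda>m. c0 (s m) (z (s m)) + (\<Sum>i\<in>UNIV. \<mu> (s m) $ i * c i (s m) (z (s m)))
      + v (s m) \<bullet> (y - z (s m)))
    \<longlonglongrightarrow> model_val P0 j0 a a + (\<Sum>i\<in>UNIV. L $ i * model_val (P i) (j i) a a) + 0 \<bullet> (y - a)"
    by (intro tendsto_intros L_nth zs sub[OF v_lim]
        sub[OF c0_tendsto[OF a_in(2) solutions_tendsto]] sub[OF c_tendsto[OF a_in(2) solutions_tendsto]])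
  moreover have "(\<lambda>m. c0 (s m) y + (\<Sum>i\<in>UNIV. \<mu> (s m) $ i * c i (s m) y))
    \<longlonglongrightarrow> model_val P0 j0 a y + (\<Sum>i\<in>UNIV. L $ i * model_val (P i) (j i) a y)"
    using y XS by (intro tendsto_intros L_nth sub[OF c0_tendsto] sub[OF c_tendsto]) auto
  ultimately have "model_val P0 j0 a a + (\<Sum>i\<in>UNIV. L $ i * model_val (P i) (j i) a a) + 0 \<bullet> (y - a)
    \<le> model_val P0 j0 a y + (\<Sum>i\<in>UNIV. L $ i * model_val (P i) (j i) a y)"
  proof (rule LIMSEQ_le, intro exI allI impI)
    fix m
    have "0 \<le> Lip P0 / 2 * (norm (y - z (s m)))\<^sup>2" using L0 by simp
    then show "c0 (s m) (z (s m)) + (\<Sum>i\<in>UNIV. \<mu> (s m) $ i * c i (s m) (z (s m)))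
        + v (s m) \<bullet> (y - z (s m)) \<le> c0 (s m) y + (\<Sum>i\<in>UNIV. \<mu> (s m) $ i * c i (s m) y)"
      using Lagrangian_inequality[OF y, of "s m"] by linarith
  qed
  then show ?thesis by simp
qed

text \<open>
  The gradient at \<open>a\<close> of the smooth, linearized part of the limiting Lagrangian.
\<close>

definition slope :: 'a where
  "slope = grad (phi P0) a - grad (psi P0 j0) a
    + (\<Sum>i\<in>UNIV. L $ i *\<^sub>R (grad (phi (P i)) a - grad (psi (P i) (j i)) a))"

lemma zeta_convex: "convex_on X (zeta P0)" "convex_on X (zeta (P i))"
  using P0 P[of i] XS X by (auto simp: dc_fun_on_def intro: convex_on_subset)

text \<open>
  The proximal quadratics of the models vanish to second order at \<open>a\<close>, hence do not affect minimality
  there: test points on the segment from \<open>a\<close> to \<open>y\<close> and let them tend to \<open>a\<close>.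
\<close>

lemma limit_minimizes_convex_Lagrangian:
  assumes y: "y \<in> X"
  shows "(\<Sum>i\<in>UNIV. L $ i * zeta (P i) a) + (zeta P0 a + slope \<bullet> a)
    \<le> (\<Sum>i\<in>UNIV. L $ i * zeta (P i) y) + (zeta P0 y + slope \<bullet> y)"
proof -
  define h where "h y = (\<Sum>i\<in>UNIV. L $ i * zeta (P i) y) + (zeta P0 y + slope \<bullet> y)" for y
  define C where "C = Lip P0 / 2 + (\<Sum>i\<in>UNIV. L $ i * (Lip (P i) / 2))"
  have "convex_on X h"
    using convex_on_inner[OF X, of 1 slope]
    unfolding h_def by (intro convex_on_add convex_on_weighted_sum zeta_convex X limit_multiplier_nonneg) auto
  have expand: "model_val p k a y - model_val p k a a = (grad (phi p) a - grad (psi p k) a) \<bullet> (y - a)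
      + (zeta p y - zeta p a) + Lip p / 2 * (norm (y - a))\<^sup>2" for p :: "'a dc_fun" and k y
    by (simp add: model_val_def phi_hat_def linearization_def inner_diff_left)
  have diff: "0 \<le> h y - h a + C * (norm (y - a))\<^sup>2" if "y \<in> X" for y
  proof -
    have "0 \<le> (model_val P0 j0 a y - model_val P0 j0 a a)
        + (\<Sum>i\<in>UNIV. L $ i * (model_val (P i) (j i) a y - model_val (P i) (j i) a a))"
      using limit_minimizes_model_Lagrangian[OF that] by (simp add: right_diff_distrib sum_subtractf)
    also have "\<dots> = h y - h a + C * (norm (y - a))\<^sup>2"
      unfolding expand h_def C_def slope_def
      by (simp add: inner_add_left inner_sum_left inner_diff_right sum.distrib sum_subtractf
          sum_distrib_left algebra_simps)
    finally show ?thesis .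
  qed
  have "0 \<le> h y - h a"
  proof (rule le_of_le_add_small)
    fix t :: real assume t: "0 < t" "t \<le> 1"
    let ?y = "(1 - t) *\<^sub>R a + t *\<^sub>R y"
    have "?y \<in> X" using X a_in y t by (intro convexD_alt) auto
    moreover have "h ?y \<le> (1 - t) * h a + t * h y"
      using \<open>convex_on X h\<close> a_in y t by (intro convex_onD) auto
    moreover have "(norm (?y - a))\<^sup>2 = t\<^sup>2 * (norm (y - a))\<^sup>2"
    proof -
      have "?y - a = t *\<^sub>R (y - a)" by (simp add: algebra_simps)
      then show ?thesis by (simp add: power_mult_distrib)
    qed
    ultimately show "t * 0 \<le> t * (h y - h a) + t\<^sup>2 * (C * (norm (y - a))\<^sup>2)"
      using diff[of ?y] by (simp add: algebra_simps)
  qed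
  then show ?thesis by (simp add: h_def)
qed

lemma zeta_subdiffI:
  assumes "\<And>y. y \<in> S \<Longrightarrow> zeta p a + u \<bullet> (y - a) \<le> zeta p y"
  shows "u \<in> zeta_subdiff S p a"
  using assms a_in(2) by (auto simp: zeta_subdiff_def subdifferential_def ind_fun_def)

text \<open>
  The sum rule replaces the constraint functions \<open>zeta\<close> and then the one of the objective by subgradients.
  What is left is a linear function that is minimal over \<open>X\<close> at \<open>a\<close>, so its negated slope is normal to \<open>X\<close>.
\<close>

lemma limit_stationary:
  "\<exists>u0 u w. u0 \<in> zeta_subdiff S P0 a \<and> (\<forall>i. u i \<in> zeta_subdiff S (P i) a) \<and> w \<in> normal_cone X a \<and>
    0 = grad (phi P0) a + u0 - grad (psi P0 j0) a
      + (\<Sum>i\<in>UNIV. L $ i *\<^sub>R (grad (phi (P i)) a + u i - grad (psi (P i) (j i)) a)) + w"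
proof -
  have cS: "convex_on S (zeta P0)" "convex_on S (zeta (P i))" for i
    using P0 P[of i] by (auto simp: dc_fun_on_def)
  have lin: "convex_on X (\<lambda>y. b \<bullet> y)" for b using convex_on_inner[OF X, of 1 b] by simp
  obtain u where u: "\<And>i y. y \<in> S \<Longrightarrow> zeta (P i) a + u i \<bullet> (y - a) \<le> zeta (P i) y"
    and min: "\<And>y. y \<in> X \<Longrightarrow> (\<Sum>i\<in>UNIV. L $ i * (u i \<bullet> a)) + (zeta P0 a + slope \<bullet> a)
      \<le> (\<Sum>i\<in>UNIV. L $ i * (u i \<bullet> y)) + (zeta P0 y + slope \<bullet> y)"
    using subgradient_sum_rule[OF S finite[of UNIV] cS(2) limit_multiplier_nonneg
        convex_on_add[OF zeta_convex(1) lin] XS a_in(1) limit_minimizes_convex_Lagrangian]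
    by blast
  define b where "b = slope + (\<Sum>i\<in>UNIV. L $ i *\<^sub>R u i)"
  have b: "b \<bullet> y = (\<Sum>i\<in>UNIV. L $ i * (u i \<bullet> y)) + slope \<bullet> y" for y
    by (simp add: b_def inner_add_left inner_sum_left)
  obtain u0 where u0: "\<And>y. y \<in> S \<Longrightarrow> zeta P0 a + u0 \<bullet> (y - a) \<le> zeta P0 y"
    and min0: "\<And>y. y \<in> X \<Longrightarrow> u0 \<bullet> a + b \<bullet> a \<le> u0 \<bullet> y + b \<bullet> y"
    using subgradient_split[OF S cS(1) lin[of b] XS a_in(1)] min unfolding b
    by (auto simp: add_ac)
  have "- (u0 + b) \<in> normal_cone X a"
    unfolding normal_cone_def
  proof clarify
    fix y assume "y \<in> X"
    from min0[OF this] show "- (u0 + b) \<bullet> (y - a) \<le> 0"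
      by (simp add: inner_diff_right inner_diff_left inner_minus_left)
  qed
  moreover have "0 = grad (phi P0) a + u0 - grad (psi P0 j0) a
      + (\<Sum>i\<in>UNIV. L $ i *\<^sub>R (grad (phi (P i)) a + u i - grad (psi (P i) (j i)) a)) + - (u0 + b)"
    by (simp add: b_def slope_def scaleR_add_right scaleR_diff_right sum.distrib sum_subtractf)
  ultimately show ?thesis using zeta_subdiffI[OF u0] zeta_subdiffI[OF u] by blast
qed

end

end

section \<open>The penalty parameters and multipliers of the method\<close>

lemma ALM_penalty_parameters:
  assumes input: "ALM_input \<epsilon> \<rho>0 \<alpha> \<sigma> lam0 \<eta>"
    and iter: "ALM_iterates X P0 P \<epsilon> \<rho>0 \<alpha> \<sigma> lam0 \<eta> x lam \<rho>"
  shows "\<rho> k > 0" and "filterlim \<rho> at_top sequentially"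
proof -
  have \<sigma>: "\<sigma> > 1" and \<rho>0: "\<rho> 0 > 0" and step: "\<sigma> * \<rho> k \<le> \<rho> (Suc k)" for k
    using input iter by (auto simp: ALM_input_def ALM_iterates_def)
  have ge: "\<rho> 0 * \<sigma> ^ k \<le> \<rho> k" for k
  proof (induction k)
    case (Suc k)
    have "\<rho> 0 * \<sigma> ^ Suc k = \<sigma> * (\<rho> 0 * \<sigma> ^ k)" by simp
    also have "\<dots> \<le> \<sigma> * \<rho> k" using Suc \<sigma> by (intro mult_left_mono) auto
    also have "\<dots> \<le> \<rho> (Suc k)" by (rule step)
    finally show ?case .
  qed simp
  show "\<rho> k > 0" using ge[of k] \<sigma> \<rho>0 by (meson less_le_trans less_trans mult_pos_pos zero_less_one zero_less_power)
  have "filterlim (\<lambda>k. \<rho> 0 * \<sigma> ^ k) at_top sequentially"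
    using \<rho>0 \<sigma> by (intro filterlim_tendsto_pos_mult_at_top[OF tendsto_const]
        filterlim_at_infinity_imp_filterlim_at_top filterlim_realpow_sequentially_gt1) auto
  then show "filterlim \<rho> at_top sequentially"
    by (rule filterlim_at_top_mono) (simp add: ge)
qed

lemma ALM_multipliers_nonneg:
  assumes input: "ALM_input \<epsilon> \<rho>0 \<alpha> \<sigma> lam0 \<eta>"
    and iter: "ALM_iterates X P0 P \<epsilon> \<rho>0 \<alpha> \<sigma> lam0 \<eta> x lam \<rho>"
  shows "lam k $ i \<ge> 0"
  using assms by (cases k) (auto simp: ALM_input_def ALM_iterates_def)

text \<open>
  The penalty update gives \<open>norm lam \<le> \<rho> powr (1 / (1 + \<alpha>))\<close>, and the exponent is less than one.
\<close>

lemma ALM_multiplier_over_penalty: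
  assumes input: "ALM_input \<epsilon> \<rho>0 \<alpha> \<sigma> lam0 \<eta>"
    and iter: "ALM_iterates X P0 P \<epsilon> \<rho>0 \<alpha> \<sigma> lam0 \<eta> x lam \<rho>"
  shows "(\<lambda>k. lam k $ i / \<rho> k) \<longlonglongrightarrow> 0"
proof -
  note \<rho> = ALM_penalty_parameters[OF assms]
  have \<alpha>: "\<alpha> > 0" using input by (simp add: ALM_input_def)
  define \<beta> where "\<beta> = 1 / (1 + \<alpha>)"
  have le: "norm (lam (Suc k) $ i / \<rho> (Suc k)) \<le> \<rho> (Suc k) powr (\<beta> - 1)" for k
  proof -
    have "norm (lam (Suc k)) powr (1 + \<alpha>) \<le> \<rho> (Suc k)"
      using iter by (simp add: ALM_iterates_def)
    then have "(norm (lam (Suc k)) powr (1 + \<alpha>)) powr \<beta> \<le> \<rho> (Suc k) powr \<beta>"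
      using \<alpha> by (intro powr_mono2) (auto simp: \<beta>_def)
    then have "norm (lam (Suc k)) \<le> \<rho> (Suc k) powr \<beta>"
      using \<alpha> by (simp add: powr_powr \<beta>_def)
    moreover have "\<bar>lam (Suc k) $ i\<bar> \<le> norm (lam (Suc k))" by (rule component_le_norm_cart)
    ultimately have "\<bar>lam (Suc k) $ i\<bar> / \<rho> (Suc k) \<le> \<rho> (Suc k) powr \<beta> / \<rho> (Suc k)"
      using \<rho>(1)[of "Suc k"] by (intro divide_right_mono) auto
    also have "\<dots> = \<rho> (Suc k) powr (\<beta> - 1)" using \<rho>(1)[of "Suc k"] by (simp add: powr_diff)
    finally show ?thesis using \<rho>(1)[of "Suc k"] by simp
  qed
  have "filterlim (\<lambda>k. \<rho> (Suc k)) at_top sequentially"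
    using \<rho>(2) by (simp add: filterlim_sequentially_Suc)
  then have "(\<lambda>k. \<rho> (Suc k) powr (\<beta> - 1)) \<longlonglongrightarrow> 0"
    using \<alpha> by (intro tendsto_neg_powr) (auto simp: \<beta>_def)
  then have "(\<lambda>k. lam (Suc k) $ i / \<rho> (Suc k)) \<longlonglongrightarrow> 0"
    by (rule Lim_null_comparison[rotated]) (simp add: le del: norm_divide real_norm_def)
  then show ?thesis by (rule LIMSEQ_imp_Suc)
qed

text \<open>
  The distance is an infimum, so it is approximated only up to a strict inequality; the slack that this
  requires is chosen to vanish along the sequence.
\<close>

lemma edist_to_set_obtain:
  assumes "edist_to_set 0 A \<le> ereal g" "g < h"
  shows "\<exists>v\<in>A. norm v < h"
proof -
  have "(INF y\<in>A. ereal (dist 0 y)) < ereal h"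
    using assms by (auto simp: edist_to_set_def intro: le_less_trans)
  then show ?thesis by (auto simp: INF_less_iff)
qed

theorem theorem4p2:
  fixes S X :: "(real ^ 'n) set"
    and P0 :: "(real ^ 'n) dc_fun" and P :: "'i::finite \<Rightarrow> (real ^ 'n) dc_fun"
    and \<epsilon> \<rho>0 \<alpha> \<sigma> :: real and lam0 :: "real ^ 'i" and \<eta> :: "nat \<Rightarrow> real"
    and x :: "nat \<Rightarrow> real ^ 'n" and lam :: "nat \<Rightarrow> real ^ 'i" and \<rho> :: "nat \<Rightarrow> real"
    and r :: "nat \<Rightarrow> nat" and xinf :: "real ^ 'n"
    and j0 :: nat and j :: "'i \<Rightarrow> nat"
    and xj :: "nat \<Rightarrow> real ^ 'n" and lamj :: "nat \<Rightarrow> real ^ 'i" and \<gamma> :: "nat \<Rightarrow> real"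
  assumes program: "dc_program S X P0 P"
    and input: "ALM_input \<epsilon> \<rho>0 \<alpha> \<sigma> lam0 \<eta>"
    and iterates: "ALM_iterates X P0 P \<epsilon> \<rho>0 \<alpha> \<sigma> lam0 \<eta> x lam \<rho>"
    and subseq: "strict_mono r"
    and conv: "(\<lambda>m. x (r m)) \<longlonglongrightarrow> xinf"
    and feasible: "xinf \<in> feasible_set X P"
    and active: "active_constraints P xinf \<noteq> {}"
    and finite_zeta0: "ereal (zeta P0 xinf) < \<infinity>"
    and pscq: "PSCQ X P xinf"
    and j0: "j0 \<in> active_pieces P0 xinf"
    and j: "j \<in> active_selections P xinf"
    and xj_in: "\<And>m. xj (r m) \<in> X"
    and xj_stat: "\<And>m. edist_to_set 0
          (subdifferential
            (\<lambda>z. ereal (Q_AL P0 P (\<rho> (r m)) z (x (r m)) (lam (r m)) j0 j) + ind_fun X z)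
            (xj (r m))) \<le> ereal (\<gamma> (r m))"
    and \<gamma>: "\<gamma> \<longlonglongrightarrow> 0"
    and lamj: "\<And>k. lamj k = model_multiplier P (\<rho> k) (xj k) (x k) (lam k) j"
  shows "(\<lambda>m. xj (r m)) \<longlonglongrightarrow> xinf \<and>
    bounded (range (\<lambda>m. lamj (r m))) \<and>
    (\<forall>laminf s. strict_mono (s :: nat \<Rightarrow> nat) \<and> (\<lambda>m. lamj (r (s m))) \<longlonglongrightarrow> laminf \<longrightarrow>
       (\<forall>i. laminf $ i \<ge> 0 \<and>
            laminf $ i * (phi (P i) xinf + zeta (P i) xinf - psi (P i) (j i) xinf) = 0) \<and>
       0 \<in> {grad (phi P0) xinf + u0 - grad (psi P0 j0) xinf +
              (\<Sum>i\<in>UNIV. laminf $ i *\<^sub>R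
                 (grad (phi (P i)) xinf + u i - grad (psi (P i) (j i)) xinf)) + v
            | u0 u v. u0 \<in> zeta_subdiff S P0 xinf \<and>
                      (\<forall>i. u i \<in> zeta_subdiff S (P i) xinf) \<and>
                      v \<in> normal_cone X xinf})"
proof -
  define D where "D m = subdifferential
      (\<lambda>y. ereal (Q_AL P0 P (\<rho> (r m)) y (x (r m)) (lam (r m)) j0 j) + ind_fun X y) (xj (r m))" for m
  have "\<exists>w. w \<in> D m \<and> norm w < \<gamma> (r m) + 1 / real (Suc m)" for m
    using edist_to_set_obtain[OF xj_stat[of m], of "\<gamma> (r m) + 1 / real (Suc m)"]
    unfolding D_def by auto
  then have "\<exists>v. \<forall>m. v m \<in> D m \<and> norm (v m) < \<gamma> (r m) + 1 / real (Suc m)"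
    by (intro choice allI)
  then obtain v where v: "\<And>m. v m \<in> D m"
    and v_less: "\<And>m. norm (v m) < \<gamma> (r m) + 1 / real (Suc m)"
    by blast
  note sub = LIMSEQ_subseq_LIMSEQ[OF _ subseq, unfolded o_def]
  have xinf: "xinf \<in> S" and S: "open S" and dc: "dc_fun_on S X P0" "\<And>i. dc_fun_on S X (P i)"
    using program feasible by (auto simp: dc_program_def feasible_set_def)
  have \<epsilon>: "\<epsilon> > 0" using input by (simp add: ALM_input_def)
  have act0: "\<forall>\<^sub>F m in sequentially. j0 \<in> eps_active_pieces \<epsilon> P0 (x (r m))"
    by (rule eventually_eps_active[OF S dc(1) xinf conv j0 \<epsilon>])
  have act: "\<forall>\<^sub>F m in sequentially. \<forall>i. j i \<in> eps_active_pieces \<epsilon> (P i) (x (r m))"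
    using j by (intro eventually_all_finite eventually_eps_active[OF S dc(2) xinf conv _ \<epsilon>])
      (auto simp: active_selections_def)
  interpret model_subproblems S X P0 P xinf j0 j "\<lambda>m. x (r m)" "\<lambda>m. xj (r m)" v
    "\<lambda>m. lam (r m)" "\<lambda>m. lamj (r m)" "\<lambda>m. \<rho> (r m)" "\<lambda>m. \<eta> (r m)"
  proof
    show "v \<longlonglongrightarrow> 0"
    proof (rule Lim_null_comparison)
      show "\<forall>\<^sub>F m in sequentially. norm (v m) \<le> \<gamma> (r m) + 1 / real (Suc m)"
        using v_less by (intro always_eventually allI less_imp_le)
      show "(\<lambda>m. \<gamma> (r m) + 1 / real (Suc m)) \<longlonglongrightarrow> 0"
        using tendsto_add[OF sub[OF \<gamma>] LIMSEQ_Suc[OF lim_1_over_n]] by simp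
    qed
    show "\<forall>\<^sub>F m in sequentially. \<forall>y\<in>X. F_AL P0 P (\<rho> (r m)) (x (r m)) (lam (r m))
        \<le> Q_AL P0 P (\<rho> (r m)) y (x (r m)) (lam (r m)) j0 j + \<eta> (r m)"
      using act0 act
    proof eventually_elim
      case (elim m)
      then have "j \<in> eps_active_selections \<epsilon> P (x (r m))" by (simp add: eps_active_selections_def)
      with elim(1) iterates show ?case unfolding ALM_iterates_def by blast
    qed
    show "Q_AL P0 P (\<rho> (r m)) (xj (r m)) (x (r m)) (lam (r m)) j0 j + v m \<bullet> (y - xj (r m))
        \<le> Q_AL P0 P (\<rho> (r m)) y (x (r m)) (lam (r m)) j0 j" if "y \<in> X" for m y
    proof -
      have "ereal (Q_AL P0 P (\<rho> (r m)) (xj (r m)) (x (r m)) (lam (r m)) j0 j) + ind_fun X (xj (r m))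
          + ereal (v m \<bullet> (y - xj (r m)))
        \<le> ereal (Q_AL P0 P (\<rho> (r m)) y (x (r m)) (lam (r m)) j0 j) + ind_fun X y"
        using v[of m] unfolding D_def subdifferential_def by blast
      then show ?thesis using that xj_in[of m] by (simp add: ind_fun_def)
    qed
    show "filterlim (\<lambda>m. \<rho> (r m)) at_top sequentially"
      using ALM_penalty_parameters(2)[OF input iterates] filterlim_subseq[OF subseq]
      by (rule filterlim_compose)
    show "(\<lambda>m. \<eta> (r m)) \<longlonglongrightarrow> 0" using input by (intro sub) (simp add: ALM_input_def)
    show "(\<lambda>m. lam (r m) $ i / \<rho> (r m)) \<longlonglongrightarrow> 0" for i
      by (rule sub[OF ALM_multiplier_over_penalty[OF input iterates]])
  qed (use program feasible pscq j0 j conv xj_in lamj ALM_penalty_parameters(1)[OF input iterates]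
      ALM_multipliers_nonneg[OF input iterates] in auto)
  show ?thesis
    using solutions_tendsto multipliers_bounded limit_multiplier_nonneg complementary_slackness
      limit_stationary
    by blast
qed

end
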